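(* Let $n$ be a positive integer. For $v\in Z_4^n$ and $i=0,1,2,3$, let $f_i$ be the number of entries of $v$ equal to $i$, and let $D_v$ denote the two-level $2^{2n}\times(2n+2)$ design generated by $(v,I_n)$. (a) Let $k\ge1$ and suppose that one of the following holds: (i) $n=3k-1$, $f_1+f_3=2k-1$, $f_2=k$; (ii) $n=3k$, $f_1+f_3=2k$, $f_2=k$; (iii) $n=3k+1$, $f_1+f_3=2k$, $f_2=k+1$. Then $D_v$ has minimum aberration among all possible two-level designs with $2^{2n}$ runs and $2n+2$ factors. Moreover, a half-fraction of $D_v$ obtained with a branching column associated with number 2 in case (i), number 1 in case (ii), number 2 in case (iii), has minimum aberration among all possible two-level designs with $2^{2n-1}$ runs and $2n+1$ factors. (b) Suppose that either $f_1+f_3=n-1$ and $f_2=1$, or $f_1+f_3=n$ and $f_2=0$. Then $D_v$ has maximum projectivity among all possible two-level designs with $2^{2n}$ runs and $2n+2$ factors, and any half-fraction of $D_v$ has maximum projectivity among all possible two-level designs with $2^{2n-1}$ runs and $2n+1$ factors.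
   Context: $Z_4=\{0,1,2,3\}$ is the ring of integers modulo 4, and $I_n$ is the $n\times n$ identity matrix. A two-level design with $N$ runs and $m$ factors is any $N\times m$ matrix with entries $\pm1$ (rows are runs, columns are factors). Design generated by $G=(v,I_n)$: let $C$ be the $2^{2n}\times(n+1)$ matrix whose rows are all linear combinations $uG$, $u\in Z_4^n$. Replace each entry of $C$ by a pair of $\pm1$ symbols via the Gray map $0\mapsto(1,1)$, $1\mapsto(1,-1)$, $2\mapsto(-1,-1)$, $3\mapsto(-1,1)$, so that column $j$ of $C$ becomes columns $2j-1,2j$. The result is a $2^{2n}\times(2n+2)$ two-level design. A column of it is associated with number $z\in\{0,1,2,3\}$ if it is one of the two columns arising from the $i$th column of $I_n$ for some $i$ such that the $i$th entry of $v$ is $z$ (i.e. columns $2i+1,2i+2$). Half-fraction: choose any column of the design (the branching column), which divides the design into two half-fractions according to the symbols of that column: keep only the runs in which the branching column takes one fixed symbol ($+1$ or $-1$), and delete the branching column; this yields a $2^{2n-1}\times(2n+1)$ design. For a two-level design $D$ with $N$ runs and $m$ factors and a nonempty set $s$ of $k$ columns, let $\rho_k(s;D)=\frac1N\left|\sum_{i=1}^N\prod_{c\in s}c_i\right|$, where $c_i$ is the $i$th entry of column $c$, and $A_k(D)=\sum_{|s|=k}\rho_k(s;D)^2$. A design has minimum aberration among a class (with the same $N$ and $m$) if its wordlength pattern $(A_1(D),\dots,A_m(D))$ is lexicographically smallest (comparing $A_1$ first, then $A_2$, etc.) in the class. A two-level design has projectivity $p$ if for every set of $p$ columns, the projection of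 the design onto these columns contains all $2^p$ level combinations in $\{\pm1\}^p$ (possibly with repetitions). "The projectivity" of a design is the largest such $p$ (it is $0$ if some column is constant). A design has maximum projectivity among a class if no design in the class has larger projectivity.
   Formalization: In (b), the claim about half-fractions is stated only for n at least 2, since for n = 1 every such D_v has two equal columns, so some half-fraction has a constant column and projectivity 0, while a 2-run, 3-factor design of projectivity 1 exists. *)

theory Defs
  imports Complex_Main "HOL-Library.Numeral_Type" "HOL-Number_Theory.Cong"
    "Jordan_Normal_Form.DL_Submatrix"
begin

section \<open>Two-level designs\<close>

definition two_level_designs :: "nat \<Rightarrow> nat \<Rightarrow> int mat set" where
  "two_level_designs N m = {D \<in> carrier_mat N m. elements_mat D \<subseteq> {1, -1}}"

definition rho :: "int mat \<Rightarrow> nat set \<Rightarrow> real" where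
  "rho D s = 1 / real (dim_row D) *
     \<bar>\<Sum>i<dim_row D. \<Prod>c\<in>s. real_of_int (D $$ (i, c))\<bar>"

definition wordlength :: "int mat \<Rightarrow> nat \<Rightarrow> real" where
  "wordlength D k = (\<Sum>s | s \<subseteq> {..<dim_col D} \<and> card s = k. (rho D s)\<^sup>2)"

definition wordlength_pattern :: "int mat \<Rightarrow> real list" where
  "wordlength_pattern D = map (wordlength D) [1..<dim_col D + 1]"

definition minimum_aberration :: "nat \<Rightarrow> nat \<Rightarrow> int mat \<Rightarrow> bool" where
  "minimum_aberration N m D \<longleftrightarrow> D \<in> two_level_designs N m \<and>
     (\<forall>E \<in> two_level_designs N m.
        wordlength_pattern D = wordlength_pattern E \<or>
        (wordlength_pattern D, wordlength_pattern E) \<in> lexord {(x, y). x < y})"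

definition has_projectivity :: "int mat \<Rightarrow> nat \<Rightarrow> bool" where
  "has_projectivity D p \<longleftrightarrow>
     (\<forall>s \<subseteq> {..<dim_col D}. card s = p \<longrightarrow>
        (\<forall>x. (\<forall>c\<in>s. x c \<in> {1, -1}) \<longrightarrow> (\<exists>i<dim_row D. \<forall>c\<in>s. D $$ (i, c) = x c)))"

text \<open>The bound \<open>p \<le> dim_col D\<close> is needed: for larger \<open>p\<close> there are no sets of \<open>p\<close> columns
  and \<open>has_projectivity D p\<close> holds vacuously.\<close>

definition projectivity :: "int mat \<Rightarrow> nat" where
  "projectivity D = Max {p. p \<le> dim_col D \<and> has_projectivity D p}"

definition maximum_projectivity :: "nat \<Rightarrow> nat \<Rightarrow> int mat \<Rightarrow> bool" where
  "maximum_projectivity N m D \<longleftrightarrow> D \<in> two_level_designs N m \<and>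
     (\<forall>E \<in> two_level_designs N m. projectivity E \<le> projectivity D)"

definition half_fraction :: "int mat \<Rightarrow> nat \<Rightarrow> int \<Rightarrow> int mat" where
  "half_fraction D b s = submatrix D {i. D $$ (i, b) = s} (- {b})"


section \<open>Designs from quaternary codes\<close>

text \<open>The ring of integers modulo 4 is the numeral type \<open>4\<close>.\<close>

definition num_entries :: "4 vec \<Rightarrow> 4 \<Rightarrow> nat" where
  "num_entries v z = card {i. i < dim_vec v \<and> v $ i = z}"

definition generator_matrix :: "4 vec \<Rightarrow> 4 mat" where
  "generator_matrix v = mat_of_cols (dim_vec v) (v # cols (1\<^sub>m (dim_vec v)))"

text \<open>The rows of \<open>all_coefficients n\<close> enumerate \<open>carrier_vec n\<close> without repetition: row \<open>r\<close>
  holds the \<open>n\<close> base-4 digits of \<open>r\<close> (\<open>of_nat\<close> into type \<open>4\<close> reduces modulo 4);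
  see \<open>bij_betw_row_all_coefficients\<close> below.\<close>

definition all_coefficients :: "nat \<Rightarrow> 4 mat" where
  "all_coefficients n = mat (2 ^ (2 * n)) n (\<lambda>(r, i). of_nat (r div 4 ^ i))"

definition code_matrix :: "4 vec \<Rightarrow> 4 mat" where
  "code_matrix v = all_coefficients (dim_vec v) * generator_matrix v"

definition gray :: "4 \<Rightarrow> int \<times> int" where
  "gray x = (if x = 0 then (1, 1) else if x = 1 then (1, -1)
             else if x = 2 then (-1, -1) else (-1, 1))"

definition quaternary_design :: "4 vec \<Rightarrow> int mat" where
  "quaternary_design v =
     (let C = code_matrix v in
        mat (dim_row C) (2 * dim_col C)
          (\<lambda>(r, c). (if even c then fst else snd) (gray (C $$ (r, c div 2)))))"

text \<open>Columns are counted from 0, so columns 0 and 1 of the design come from \<open>v\<close>, and columns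
  \<open>2 * i + 2\<close> and \<open>2 * i + 3\<close> come from column \<open>i\<close> of the identity matrix.\<close>

definition associated_columns :: "4 vec \<Rightarrow> 4 \<Rightarrow> nat set" where
  "associated_columns v z = {c. \<exists>i<dim_vec v. v $ i = z \<and> (c = 2 * i + 2 \<or> c = 2 * i + 3)}"


section \<open>Basic properties\<close>

lemma generator_matrix_carrier:
  "generator_matrix v \<in> carrier_mat (dim_vec v) (dim_vec v + 1)"
  using mat_of_cols_carrier(1)[of "dim_vec v" "v # cols (1\<^sub>m (dim_vec v))"]
  by (simp add: generator_matrix_def)

lemma code_matrix_carrier:
  "code_matrix v \<in> carrier_mat (2 ^ (2 * dim_vec v)) (dim_vec v + 1)"
  unfolding code_matrix_def all_coefficients_def
  by (rule mult_carrier_mat[OF mat_carrier generator_matrix_carrier])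

lemma z4_of_nat_eq_iff: "(of_nat a :: 4) = of_nat b \<longleftrightarrow> a mod 4 = b mod 4"
  using of_nat_eq_iff_cong_CHAR[where 'a = 4, of a b] by (simp add: cong_def)

lemma base4_digits_inj:
  assumes "a < 4 ^ n" "b < 4 ^ n" "\<And>i. i < n \<Longrightarrow> a div 4 ^ i mod 4 = b div 4 ^ i mod (4 :: nat)"
  shows "a = b"
  using assms
proof (induction n arbitrary: a b)
  case (Suc n)
  have "a div 4 = b div 4"
  proof (rule Suc.IH)
    show "a div 4 div 4 ^ i mod 4 = b div 4 div 4 ^ i mod 4" if "i < n" for i
      using Suc.prems(3)[of "Suc i"] that by (simp add: div_mult2_eq)
  qed (use Suc.prems(1,2) in auto)
  moreover have "a mod 4 = b mod 4"
    using Suc.prems(3)[of 0] by simp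
  ultimately show ?case
    by (metis div_mult_mod_eq)
qed simp

lemma bij_betw_row_all_coefficients:
  "bij_betw (row (all_coefficients n)) {..<2 ^ (2 * n)} (carrier_vec n)"
proof -
  let ?r = "row (all_coefficients n)"
  have inj: "inj_on ?r {..<2 ^ (2 * n)}"
  proof (rule inj_onI)
    fix a b assume ab: "a \<in> {..<2 ^ (2 * n)}" "b \<in> {..<2 ^ (2 * n)}" "?r a = ?r b"
    show "a = b"
    proof (rule base4_digits_inj)
      show "a < 4 ^ n" "b < 4 ^ n"
        using ab by (simp_all add: power_mult)
      fix i assume "i < n"
      then have "?r a $ i = (of_nat (a div 4 ^ i) :: 4)" "?r b $ i = of_nat (b div 4 ^ i)"
        using ab(1,2) by (simp_all add: all_coefficients_def)
      then show "a div 4 ^ i mod 4 = b div 4 ^ i mod 4"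
        using ab(3) z4_of_nat_eq_iff by metis
    qed
  qed
  let ?S = "{xs :: 4 list. set xs \<subseteq> UNIV \<and> length xs = n}"
  have vecs: "carrier_vec n = vec_of_list ` ?S"
  proof (intro equalityI subsetI)
    fix w :: "4 vec" assume "w \<in> carrier_vec n"
    then have "list_of_vec w \<in> ?S" "w = vec_of_list (list_of_vec w)"
      by (auto simp: vec_list)
    then show "w \<in> vec_of_list ` ?S"
      by (rule rev_image_eqI)
  next
    fix w :: "4 vec" assume "w \<in> vec_of_list ` ?S"
    then obtain xs where "w = vec_of_list xs" "length xs = n"
      by (elim imageE CollectE conjE)
    then show "w \<in> carrier_vec n"
      by (intro carrier_vecI) (simp only: dim_vec_of_list)
  qed
  have S: "finite ?S"
    by (rule finite_lists_length_eq) simp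
  have "card ?S = 4 ^ n"
    by (subst card_lists_length_eq) simp_all
  then have "finite (carrier_vec n :: 4 vec set)" "card (carrier_vec n :: 4 vec set) \<le> 4 ^ n"
    unfolding vecs using S card_image_le[OF S, of vec_of_list] by (simp_all only: finite_imageI)
  moreover have "?r ` {..<2 ^ (2 * n)} \<subseteq> carrier_vec n"
    by (auto simp: all_coefficients_def)
  moreover have "card (?r ` {..<2 ^ (2 * n)}) = 4 ^ n"
    unfolding card_image[OF inj] by (simp add: power_mult)
  ultimately show ?thesis
    using inj card_seteq unfolding bij_betw_def by (metis order_eq_refl)
qed

lemma row_code_matrix:
  assumes "r < 2 ^ (2 * dim_vec v)"
  shows "row (code_matrix v) r =
    (generator_matrix v)\<^sup>T *\<^sub>v row (all_coefficients (dim_vec v)) r"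
proof -
  let ?n = "dim_vec v" and ?G = "generator_matrix v"
  let ?U = "all_coefficients ?n"
  have G: "dim_row ?G = ?n" "dim_col ?G = ?n + 1"
    using generator_matrix_carrier[of v] by auto
  have U: "dim_row ?U = 2 ^ (2 * ?n)" "dim_col ?U = ?n"
    unfolding all_coefficients_def by (rule dim_row_mat, rule dim_col_mat)
  have "row (?U * ?G) r $ i = (?G\<^sup>T *\<^sub>v row ?U r) $ i" if i: "i < ?n + 1" for i
  proof -
    have "row (?U * ?G) r $ i = row ?U r \<bullet> col ?G i"
      using assms i G U by (simp only: index_row index_mult_mat)
    also have "\<dots> = col ?G i \<bullet> row ?U r"
      by (rule comm_scalar_prod[of _ ?n]; rule carrier_vecI) (simp_all add: G U)
    also have "\<dots> = (?G\<^sup>T *\<^sub>v row ?U r) $ i"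
      using i G by (simp only: index_mult_mat_vec index_transpose_mat row_transpose)
    finally show ?thesis .
  qed
  then show ?thesis
    unfolding code_matrix_def by (intro eq_vecI) (simp_all add: G)
qed

lemma quaternary_design_in_two_level_designs:
  assumes "v \<in> carrier_vec n"
  shows "quaternary_design v \<in> two_level_designs (2 ^ (2 * n)) (2 * n + 2)"
proof -
  have "quaternary_design v \<in> carrier_mat (2 ^ (2 * n)) (2 * n + 2)"
    using assms code_matrix_carrier[of v] by (auto simp: quaternary_design_def Let_def)
  moreover have "elements_mat (quaternary_design v) \<subseteq> {1, -1}"
  proof
    fix x assume "x \<in> elements_mat (quaternary_design v)"
    then have "\<exists>z. x = fst (gray z) \<or> x = snd (gray z)"
      by (fastforce simp: quaternary_design_def Let_def dest!: elements_matD split: if_splits)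
    then show "x \<in> {1, -1}"
      by (fastforce simp: gray_def split: if_splits)
  qed
  ultimately show ?thesis
    by (simp add: two_level_designs_def)
qed

lemma projectivity_eq_0:
  assumes "dim_row D > 0" "c < dim_col D" "\<And>i. i < dim_row D \<Longrightarrow> D $$ (i, c) = 1"
  shows "projectivity D = 0"
proof -
  have "\<not> has_projectivity D p" if p: "0 < p" "p \<le> dim_col D" for p
  proof
    assume *: "has_projectivity D p"
    have "p - 1 \<le> card ({..<dim_col D} - {c})"
      using p assms(2) by simp
    then obtain t where t: "t \<subseteq> {..<dim_col D} - {c}" "card t = p - 1" "finite t"
      by (meson obtain_subset_with_card_n)
    have "insert c t \<subseteq> {..<dim_col D}" "card (insert c t) = p"
      using t p assms(2) by (auto simp: card_insert_if)
    then have "\<exists>i<dim_row D. \<forall>c'\<in>insert c t. D $$ (i, c') = -1"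
      using * unfolding has_projectivity_def by (elim allE[of _ "insert c t"]) auto
    then show False
      using assms(3) by force
  qed
  moreover have "has_projectivity D 0"
    using assms(1) finite_subset[OF _ finite_lessThan, of _ "dim_col D"]
    by (auto simp: has_projectivity_def card_eq_0_iff)
  ultimately have "p \<le> dim_col D \<and> has_projectivity D p \<longleftrightarrow> p = 0" for p
    by (cases "p = 0") auto
  then show ?thesis
    by (simp add: projectivity_def)
qed

text \<open>For \<open>n = 1\<close> a half-fraction can have a constant column, hence projectivity 0, while
  there is a two-level design with 2 runs and 3 factors of projectivity 1.\<close>

lemma half_fraction_not_maximum_projectivity:
  assumes "v \<in> carrier_vec 1" "v $ 0 = 1 \<or> v $ 0 = 2"
  shows "\<not> maximum_projectivity 2 3 (half_fraction (quaternary_design v) 0 1)"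
proof
  let ?D = "quaternary_design v"
  let ?H = "half_fraction ?D 0 1"
  let ?E = "mat 2 3 (\<lambda>(i, j). if i = 0 then 1 else -1) :: int mat"
  let ?I = "{i. ?D $$ (i, 0) = 1}"
  assume max: "maximum_projectivity 2 3 ?H"
  then have dim: "dim_row ?H = 2" "dim_col ?H = 3"
    by (auto simp: maximum_projectivity_def two_level_designs_def)
  have "\<exists>c<3. \<forall>i<2. ?H $$ (i, c) = 1"
  proof -
    have n: "dim_vec v = 1"
      using assms(1) by simp
    have D: "dim_row ?D = 4" "dim_col ?D = 4"
      using quaternary_design_in_two_level_designs[OF assms(1)]
      by (auto simp: two_level_designs_def)
    have C: "code_matrix v $$ (r, 0) = of_nat r * v $ 0"
      "code_matrix v $$ (r, 1) = of_nat r" if "r < 4" for r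
      using that n by (simp_all add: code_matrix_def all_coefficients_def generator_matrix_def
          scalar_prod_def mat_of_cols_def)
    have ent: "?D $$ (r, 0) = fst (gray (of_nat r * v $ 0))"
      "?D $$ (r, 1) = snd (gray (of_nat r * v $ 0))"
      "?D $$ (r, 2) = fst (gray (of_nat r))" if "r < 4" for r
      using that n C[OF that] code_matrix_carrier[of v]
      by (simp_all add: quaternary_design_def Let_def)
    have pick: "pick (- {0}) 0 = 1" "pick (- {0}) 1 = 2"
    proof -
      show 1: "pick (- {0}) 0 = 1"
        by (auto intro: Least_equality)
      have "(LEAST a. a \<in> - {0} \<and> a > 1) = (2 :: nat)"
        by (rule Least_equality) auto
      then show "pick (- {0}) 1 = 2"
        using 1 by simp
    qed
    have H: "\<exists>r<4. ?D $$ (r, 0) = 1 \<and> ?H $$ (i, 0) = ?D $$ (r, 1) \<and> ?H $$ (i, 1) = ?D $$ (r, 2)"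
      if "i < 2" for i
    proof -
      have i: "i < card {i. i < dim_row ?D \<and> i \<in> ?I}"
        using dim(1) that by (simp add: half_fraction_def dim_submatrix)
      have j: "j < card {j. j < dim_col ?D \<and> j \<in> - {0}}" if "j < 2" for j
        using dim(2) that by (simp add: half_fraction_def dim_submatrix)
      have "pick ?I i < 4" "pick ?I i \<in> ?I"
        using pick_le[OF i] D(1) pick_reduce_set[OF i] pick_in_set_le[OF i] by auto
      then show ?thesis
        using submatrix_index[OF i j] pick by (auto simp: half_fraction_def)
    qed
    show ?thesis
    proof (cases "v $ 0 = 1")
      case True
      then show ?thesis
        using H ent(1,3) by (intro exI[of _ 1]) (metis mult.right_neutral one_less_numeral_iff semiring_norm(77))
    next
      case False
      have "snd (gray (of_nat r * 2)) = 1" if "r < 4" "fst (gray (of_nat r * 2)) = 1" for r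
      proof -
        have "r \<in> {0, 1, 2, 3}"
          using that(1) by auto
        then show ?thesis
          using that(2) by (auto simp: gray_def)
      qed
      then show ?thesis
        using False assms(2) H ent by (intro exI[of _ 0]) force
    qed
  qed
  then have "projectivity ?H = 0"
    using projectivity_eq_0[of ?H] dim by auto
  moreover have "1 \<le> projectivity ?E"
    unfolding projectivity_def
  proof (rule Max_ge)
    have "has_projectivity ?E 1"
      unfolding has_projectivity_def
    proof (intro allI impI)
      fix s x assume s: "s \<subseteq> {..<dim_col ?E}" "card s = 1" "\<forall>c\<in>s. x c \<in> {1, - 1 :: int}"
      then obtain c where c: "s = {c}"
        by (auto simp: card_1_singleton_iff)
      show "\<exists>i<dim_row ?E. \<forall>c\<in>s. ?E $$ (i, c) = x c"
        using s c by (intro exI[of _ "if x c = 1 then 0 else 1"]) auto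
    qed
    then show "1 \<in> {p. p \<le> dim_col ?E \<and> has_projectivity ?E p}"
      by simp
  qed simp
  moreover have "?E \<in> two_level_designs 2 3"
    by (auto simp: two_level_designs_def elements_mat_def)
  ultimately show False
    using max unfolding maximum_projectivity_def by fastforce
qed

end

theory Submission
  imports Defs
begin

text \<open>All designs in question have \<open>2 ^ (m - 2)\<close> runs on \<open>m\<close> factors. For any design with \<open>N\<close> runs,
  expanding the squares shows that \<open>1 + A\<^sub>1 + \<dots> + A\<^sub>m\<close> counts pairs of equal runs and
  \<open>m + (m - 2) A\<^sub>1 + (m - 4) A\<^sub>2 + \<dots> - m A\<^sub>m\<close> counts pairs of runs at distance 1, each up to a positive
  factor. Hence the first sum is at least \<open>2 ^ m / N\<close> and the second is nonnegative, with equality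
  in both for a design without pairs of runs at distance at most 1. If moreover all words of such a
  design have one of two consecutive lengths, which exceed \<open>m / 2\<close> up to rounding, the two
  inequalities force it to have minimum aberration.

  The words of the quaternary design are restricted by shifting the coefficient vector in a single
  position: a shift that permutes the runs but changes the sign of a word makes the word vanish.
  Apart from the empty word, this leaves words of the two lengths \<open>2 (f\<^sub>1 + f\<^sub>3 + 1)\<close> and
  \<open>f\<^sub>1 + f\<^sub>3 + 1 + 2 f\<^sub>2\<close>.

  No design with \<open>2 ^ (m - 2)\<close> runs on \<open>m \<ge> 4\<close> factors has projectivity \<open>m - 2\<close> or more. The
  quaternary design attains \<open>m - 3\<close>, because prescribing all but three columns leaves enough freedom
  to solve the linear equation over the integers modulo 4 that defines the code.\<close>

section \<open>The wordlength pattern and pairs of runs\<close>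

text \<open>The sum inside \<open>rho\<close>, kept signed and integral: the shift argument and the
  half-fraction identity both depend on its sign.\<close>

definition word_sum :: "int mat \<Rightarrow> nat set \<Rightarrow> int" where
  "word_sum D s = (\<Sum>i<dim_row D. \<Prod>c\<in>s. D $$ (i, c))"

lemma two_level_designs_entry:
  assumes "D \<in> two_level_designs N m" "i < N" "c < m"
  shows "D $$ (i, c) = 1 \<or> D $$ (i, c) = -1"
  using assms unfolding two_level_designs_def by (fastforce simp: elements_mat_def)

lemma rho_sq: "(rho D s)\<^sup>2 = (real_of_int (word_sum D s))\<^sup>2 / (real (dim_row D))\<^sup>2"
  by (simp add: rho_def word_sum_def power_mult_distrib power_divide)

lemma sum_Pow_prod:
  fixes z :: "nat \<Rightarrow> 'a :: comm_semiring_1"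
  assumes "finite M"
  shows "(\<Sum>s\<in>Pow M. \<Prod>c\<in>s. z c) = (\<Prod>c\<in>M. z c + 1)"
  using prod_add[OF assms, of z "\<lambda>_. 1"] by simp

lemma sum_wordlength:
  "(\<Sum>k\<le>dim_col D. g k * wordlength D k)
     = (\<Sum>s\<in>Pow {..<dim_col D}. g (card s) * (rho D s)\<^sup>2)"
proof -
  have "(\<Sum>k\<le>dim_col D. g k * wordlength D k)
      = (\<Sum>k\<le>dim_col D. \<Sum>s | s \<in> Pow {..<dim_col D} \<and> card s = k. g (card s) * (rho D s)\<^sup>2)"
    unfolding wordlength_def sum_distrib_left by (intro sum.cong) auto
  also have "\<dots> = (\<Sum>s\<in>Pow {..<dim_col D}. g (card s) * (rho D s)\<^sup>2)"
    by (rule sum.group) (auto simp: card_mono[of "{..<dim_col D}", simplified])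
  finally show ?thesis .
qed

lemma wordlength_0:
  assumes "dim_row D > 0"
  shows "wordlength D 0 = 1"
proof -
  have "{s. s \<subseteq> {..<dim_col D} \<and> card s = 0} = {{}}"
    using finite_subset[of _ "{..<dim_col D}"] by auto
  then show ?thesis
    using assms by (simp add: wordlength_def rho_def)
qed

lemma wordlength_nonneg: "0 \<le> wordlength D k"
  unfolding wordlength_def by (intro sum_nonneg) simp

text \<open>Squaring a sum over runs gives a double sum over pairs of runs, so any weighted sum of
  squared \<open>rho\<close> becomes a statistic of pairs.\<close>

lemma sum_Pow_rho_sq:
  "(\<Sum>s\<in>Pow {..<dim_col D}. g s * (rho D s)\<^sup>2) * (real (dim_row D))\<^sup>2 =
    (\<Sum>i<dim_row D. \<Sum>j<dim_row D. \<Sum>s\<in>Pow {..<dim_col D}.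
        g s * real_of_int (\<Prod>c\<in>s. D $$ (i, c) * D $$ (j, c)))"
proof (cases "dim_row D = 0")
  case False
  let ?N = "dim_row D"
  have "(\<Sum>s\<in>Pow {..<dim_col D}. g s * (rho D s)\<^sup>2) * (real ?N)\<^sup>2 =
    (\<Sum>s\<in>Pow {..<dim_col D}. g s * real_of_int (word_sum D s * word_sum D s))"
    unfolding sum_distrib_right rho_sq using False by (intro sum.cong) (auto simp: power2_eq_square)
  also have "\<dots> = (\<Sum>s\<in>Pow {..<dim_col D}. \<Sum>i<?N. \<Sum>j<?N.
        g s * real_of_int (\<Prod>c\<in>s. D $$ (i, c) * D $$ (j, c)))"
    unfolding word_sum_def sum_product of_int_sum prod.distrib
    unfolding sum_distrib_left ..
  also have "\<dots> = (\<Sum>i<?N. \<Sum>s\<in>Pow {..<dim_col D}. \<Sum>j<?N. 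
        g s * real_of_int (\<Prod>c\<in>s. D $$ (i, c) * D $$ (j, c)))"
    by (rule sum.swap)
  also have "\<dots> = (\<Sum>i<?N. \<Sum>j<?N. \<Sum>s\<in>Pow {..<dim_col D}. 
        g s * real_of_int (\<Prod>c\<in>s. D $$ (i, c) * D $$ (j, c)))"
    by (intro sum.cong refl sum.swap)
  finally show ?thesis .
qed simp

text \<open>For a design with at least one column this is minimum Hamming distance at least 2;
  exempting an arbitrary column \<open>b\<close> covers distances 0 and 1 at once.\<close>

definition rows_differ :: "int mat \<Rightarrow> bool" where
  "rows_differ D \<longleftrightarrow> (\<forall>i<dim_row D. \<forall>j<dim_row D. i \<noteq> j \<longrightarrow>
     (\<forall>b<dim_col D. \<exists>c<dim_col D. c \<noteq> b \<and> D $$ (i, c) \<noteq> D $$ (j, c)))"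

context
  fixes D :: "int mat" and N m :: nat
  assumes D: "D \<in> two_level_designs N m" and pos: "N > 0" "m > 0"
begin

private lemma dims: "dim_row D = N" "dim_col D = m"
  using D by (auto simp: two_level_designs_def)

private lemma entry: "i < N \<Longrightarrow> c < m \<Longrightarrow> D $$ (i, c) = 1 \<or> D $$ (i, c) = -1"
  using two_level_designs_entry[OF D] .

text \<open>The sum over all column sets factors into one factor per column, which is 2 where the
  runs agree and 0 where they differ.\<close>

private lemma total_pair:
  assumes "i < N" "j < N"
  shows "(\<Sum>s\<in>Pow {..<m}. 1 * real_of_int (\<Prod>c\<in>s. D $$ (i, c) * D $$ (j, c))) =
     (if \<forall>c<m. D $$ (i, c) = D $$ (j, c) then 2 ^ m else 0)"
proof -
  have e: "D $$ (i, c) * D $$ (j, c) + 1 = (if D $$ (i, c) = D $$ (j, c) then 2 else 0)"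
    if "c < m" for c
    using entry[OF assms(1) that] entry[OF assms(2) that] by auto
  have "(\<Sum>s\<in>Pow {..<m}. \<Prod>c\<in>s. D $$ (i, c) * D $$ (j, c)) =
      (\<Prod>c<m. if D $$ (i, c) = D $$ (j, c) then 2 else 0)"
    by (simp add: sum_Pow_prod e del: prod.distrib cong: prod.cong_simp)
  also have "\<dots> = (if \<forall>c<m. D $$ (i, c) = D $$ (j, c) then 2 ^ m else 0)"
    by (auto simp: prod_zero_iff cong: prod.cong_simp)
  finally have "real_of_int (\<Sum>s\<in>Pow {..<m}. \<Prod>c\<in>s. D $$ (i, c) * D $$ (j, c)) = 
     (if \<forall>c<m. D $$ (i, c) = D $$ (j, c) then 2 ^ m else 0)"
    by simp
  then show ?thesis by (simp del: of_int_prod)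
qed

private lemma total_sum:
  "real N * ((\<Sum>k\<le>m. wordlength D k) * real N) =
     (\<Sum>i<N. \<Sum>j<N. if \<forall>c<m. D $$ (i, c) = D $$ (j, c) then 2 ^ m else 0)"
proof -
  have "real N * ((\<Sum>k\<le>m. wordlength D k) * real N) =
      (\<Sum>s\<in>Pow {..<m}. 1 * (rho D s)\<^sup>2) * (real N)\<^sup>2"
    using sum_wordlength[of "\<lambda>_. 1" D] by (simp add: dims power2_eq_square)
  also have "\<dots> = (\<Sum>i<N. \<Sum>j<N. \<Sum>s\<in>Pow {..<m}.
      1 * real_of_int (\<Prod>c\<in>s. D $$ (i, c) * D $$ (j, c)))"
    using sum_Pow_rho_sq[where g = "\<lambda>_. 1" and D = D] unfolding dims .
  also have "\<dots> = (\<Sum>i<N. \<Sum>j<N. if \<forall>c<m. D $$ (i, c) = D $$ (j, c) then 2 ^ m else 0)"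
    by (intro sum.cong refl total_pair) simp_all
  finally show ?thesis .
qed

text \<open>The \<open>N\<close> diagonal pairs alone contribute \<open>N * 2 ^ m\<close>, and no
  pair contributes negatively.\<close>

lemma total_ge: "2 ^ m \<le> (\<Sum>k\<le>m. wordlength D k) * real N"
proof -
  have "real N * 2 ^ m = (\<Sum>i<N. \<Sum>j<N. if j = i then 2 ^ m else 0)"
    by simp
  also have "\<dots> \<le> (\<Sum>i<N. \<Sum>j<N. if \<forall>c<m. D $$ (i, c) = D $$ (j, c) then 2 ^ m else 0)"
    by (intro sum_mono) auto
  also note total_sum[symmetric]
  finally show ?thesis
    using pos by simp
qed

lemma total_eq:
  assumes "rows_differ D"
  shows "(\<Sum>k\<le>m. wordlength D k) * real N = 2 ^ m"
proof -
  have same: "(\<forall>c<m. D $$ (i, c) = D $$ (j, c)) \<longleftrightarrow> j = i" if "i < N" "j < N" for i j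
    using assms pos that unfolding rows_differ_def dims by metis
  note total_sum
  also have "(\<Sum>i<N. \<Sum>j<N. if \<forall>c<m. D $$ (i, c) = D $$ (j, c) then 2 ^ m else 0) =
      (\<Sum>i<N. \<Sum>j<N. if j = i then 2 ^ m else (0 :: real))"
    by (intro sum.cong refl if_cong same) simp_all
  finally show ?thesis
    using pos by simp
qed

text \<open>Writing \<open>m - 2 |s|\<close> as a sum of signs over the \<open>m\<close> columns, the inner sum becomes a sum of
  products, the \<open>b\<close>-th of which detects whether the two runs differ in column \<open>b\<close> only.\<close>

private lemma moment_pair:
  assumes "i < N" "j < N"
  shows "(\<Sum>s\<in>Pow {..<m}. (real m - 2 * real (card s)) *
        real_of_int (\<Prod>c\<in>s. D $$ (i, c) * D $$ (j, c))) =
     (\<Sum>b<m. if \<forall>c<m. D $$ (i, c) = D $$ (j, c) \<longleftrightarrow> c \<noteq> b then 2 ^ m else 0)"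
proof -
  let ?z = "\<lambda>c. D $$ (i, c) * D $$ (j, c)"
  let ?e = "\<lambda>b c. if c = b then -1 else (1 :: int)"
  have signs: "(int m - 2 * int (card s)) = (\<Sum>b<m. \<Prod>c\<in>s. ?e b c)" if "s \<subseteq> {..<m}" for s
  proof -
    have fin: "finite s" using that by (rule finite_subset) simp
    have "(\<Sum>b<m. \<Prod>c\<in>s. ?e b c) = (\<Sum>b<m. 1 - 2 * (if b \<in> s then 1 else 0))"
      using fin by (intro sum.cong refl) (simp add: prod.delta)
    also have "\<dots> = int m - 2 * (\<Sum>b\<in>{..<m}. if b \<in> s then 1 else 0)"
      by (simp add: sum_subtractf sum_distrib_left)
    also have "(\<Sum>b\<in>{..<m}. if b \<in> s then 1 else 0) = int (card s)"
      using that by (simp flip: sum.inter_restrict add: Int_absorb1)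
    finally show ?thesis by simp
  qed
  have e: "?e b c * ?z c + 1 = (if D $$ (i, c) = D $$ (j, c) \<longleftrightarrow> c \<noteq> b then 2 else 0)"
    if "c < m" for b c
    using entry[OF assms(1) that] entry[OF assms(2) that] by auto
  have "(\<Sum>s\<in>Pow {..<m}. (int m - 2 * int (card s)) * (\<Prod>c\<in>s. ?z c)) =
      (\<Sum>s\<in>Pow {..<m}. \<Sum>b<m. \<Prod>c\<in>s. ?e b c * ?z c)"
    by (intro sum.cong refl) (simp only: Pow_iff signs sum_distrib_right flip: prod.distrib)
  also have "\<dots> = (\<Sum>b<m. \<Sum>s\<in>Pow {..<m}. \<Prod>c\<in>s. ?e b c * ?z c)"
    by (rule sum.swap)
  also have "\<dots> = (\<Sum>b<m. \<Prod>c<m. if D $$ (i, c) = D $$ (j, c) \<longleftrightarrow> c \<noteq> b then 2 else 0)"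
    by (intro sum.cong refl, subst sum_Pow_prod) (auto intro!: prod.cong e simp del: prod.distrib)
  also have "\<dots> = (\<Sum>b<m. if \<forall>c<m. D $$ (i, c) = D $$ (j, c) \<longleftrightarrow> c \<noteq> b then 2 ^ m else 0)"
    by (intro sum.cong refl) (auto simp: prod_zero_iff cong: prod.cong_simp)
  finally have "real_of_int (\<Sum>s\<in>Pow {..<m}. (int m - 2 * int (card s)) * (\<Prod>c\<in>s. ?z c)) =
     real_of_int (\<Sum>b<m. if \<forall>c<m. D $$ (i, c) = D $$ (j, c) \<longleftrightarrow> c \<noteq> b then 2 ^ m else 0)"
    by (rule arg_cong)
  then show ?thesis
    by (simp del: of_int_prod add: of_int_sum if_distrib[of real_of_int] cong: if_cong)
qed

private lemma moment_sum:
  "(\<Sum>k\<le>m. (real m - 2 * real k) * wordlength D k) * (real N)\<^sup>2 =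
     (\<Sum>i<N. \<Sum>j<N. \<Sum>b<m. if \<forall>c<m. D $$ (i, c) = D $$ (j, c) \<longleftrightarrow> c \<noteq> b then 2 ^ m else 0)"
proof -
  have "(\<Sum>k\<le>m. (real m - 2 * real k) * wordlength D k) * (real N)\<^sup>2 =
      (\<Sum>i<N. \<Sum>j<N. \<Sum>s\<in>Pow {..<m}. (real m - 2 * real (card s)) *
        real_of_int (\<Prod>c\<in>s. D $$ (i, c) * D $$ (j, c)))"
    using sum_wordlength[of "\<lambda>k. real m - 2 * real k" D]
      sum_Pow_rho_sq[where g = "\<lambda>s. real m - 2 * real (card s)" and D = D] unfolding dims by simp
  also have "\<dots> = (\<Sum>i<N. \<Sum>j<N. \<Sum>b<m.
      if \<forall>c<m. D $$ (i, c) = D $$ (j, c) \<longleftrightarrow> c \<noteq> b then 2 ^ m else 0)"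
    by (intro sum.cong refl moment_pair) simp_all
  finally show ?thesis .
qed

lemma moment_ge: "0 \<le> (\<Sum>k\<le>m. (real m - 2 * real k) * wordlength D k)"
proof -
  have "0 \<le> (\<Sum>k\<le>m. (real m - 2 * real k) * wordlength D k) * (real N)\<^sup>2"
    unfolding moment_sum by (intro sum_nonneg) auto
  then show ?thesis
    using pos by (simp add: zero_le_mult_iff)
qed

lemma moment_eq:
  assumes "rows_differ D"
  shows "(\<Sum>k\<le>m. (real m - 2 * real k) * wordlength D k) = 0"
proof -
  \<comment> \<open>Equal indices fail at column \<open>b\<close> itself; distinct runs differ in
    some column other than \<open>b\<close>.\<close>
  have "\<not> (\<forall>c<m. D $$ (i, c) = D $$ (j, c) \<longleftrightarrow> c \<noteq> b)" if "i < N" "j < N" "b < m" for i j b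
    using assms that unfolding rows_differ_def dims by (cases "i = j") metis+
  then have "(\<Sum>k\<le>m. (real m - 2 * real k) * wordlength D k) * (real N)\<^sup>2 = 0"
    unfolding moment_sum by (intro sum.neutral ballI) auto
  then show ?thesis
    using pos by simp
qed

end

section \<open>Lexicographic comparison and a criterion for minimum aberration\<close>

lemma lexord_map_upt:
  fixes f g :: "nat \<Rightarrow> real"
  assumes "\<And>j. 1 \<le> j \<Longrightarrow> j \<le> m \<Longrightarrow> (\<And>i. 1 \<le> i \<Longrightarrow> i < j \<Longrightarrow> f i = g i) \<Longrightarrow> f j \<le> g j"
  shows "map f [1..<m + 1] = map g [1..<m + 1] \<or>
    (map f [1..<m + 1], map g [1..<m + 1]) \<in> lexord {(x, y). x < y}"
proof (cases "\<exists>j. 1 \<le> j \<and> j \<le> m \<and> f j \<noteq> g j")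
  case True
  define j where "j = (LEAST j. 1 \<le> j \<and> j \<le> m \<and> f j \<noteq> g j)"
  have j: "1 \<le> j" "j \<le> m" "f j \<noteq> g j"
    using LeastI_ex[OF True] unfolding j_def by auto
  have less: "f i = g i" if "1 \<le> i" "i < j" for i
    using not_less_Least[of i "\<lambda>j. 1 \<le> j \<and> j \<le> m \<and> f j \<noteq> g j"] that j(2)
    unfolding j_def[symmetric] by auto
  \<comment> \<open>At the first disagreement the hypothesis applies, and its weak inequality is
    strict.\<close>
  have "f j < g j"
    using assms[of j] j less by force
  moreover have "take (j - 1) (map f [1..<m + 1]) = take (j - 1) (map g [1..<m + 1])"
    using j less by (simp add: take_map take_upt del: upt_Suc)
  ultimately have "(map f [1..<m + 1], map g [1..<m + 1]) \<in> lexord {(x, y). x < y}"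
    unfolding lexord_take_index_conv using j by (intro disjI2 exI[of _ "j - 1"]) (simp del: upt_Suc)
  then show ?thesis ..
qed simp

text \<open>The two inequalities \<open>total_ge\<close> and \<open>moment_ge\<close>, combined so that the words of length
  \<open>K + 1\<close> cancel, bound the number of words of length \<open>K\<close> from below when there are no shorter
  ones; \<open>total_ge\<close> alone then bounds the number of words of length \<open>K + 1\<close>.\<close>

lemma minimum_aberration_criterion:
  assumes D: "D \<in> two_level_designs N m" and N: "N > 0"
    and K: "1 \<le> K" "K \<le> m" "m < 2 * (K + 1)"
    and differ: "rows_differ D"
    and support: "\<And>s. s \<subseteq> {..<m} \<Longrightarrow> word_sum D s \<noteq> 0 \<Longrightarrow> s = {} \<or> card s = K \<or> card s = K + 1"
  shows "minimum_aberration N m D"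
  unfolding minimum_aberration_def
proof (intro conjI ballI D)
  fix E assume E: "E \<in> two_level_designs N m"
  have dims: "dim_row D = N" "dim_col D = m" "dim_row E = N" "dim_col E = m"
    using D E by (auto simp: two_level_designs_def)
  have m: "m > 0" using K by simp
  let ?d = "wordlength D" and ?e = "wordlength E"
  have d0: "?d j = 0" if "1 \<le> j" "j \<noteq> K" "j \<noteq> K + 1" for j
  proof -
    have "rho D s = 0" if "s \<subseteq> {..<m}" "card s = j" for s
    proof -
      have "s \<noteq> {}" using that \<open>1 \<le> j\<close> by auto
      then have "word_sum D s = 0" using support[OF that(1)] that \<open>j \<noteq> K\<close> \<open>j \<noteq> K + 1\<close> by auto
      then have "(rho D s)\<^sup>2 = 0" unfolding rho_sq by simp
      then show ?thesis by simp
    qed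
    then show ?thesis
      unfolding wordlength_def dims by (intro sum.neutral) auto
  qed
  have nonneg: "0 \<le> ?e j" for j
    by (rule wordlength_nonneg)
  have "(\<Sum>k\<le>m. ?d k) * real N \<le> (\<Sum>k\<le>m. ?e k) * real N"
    using total_eq[OF D N m differ] total_ge[OF E N m] by simp
  then have total: "(\<Sum>k\<le>m. ?d k) \<le> (\<Sum>k\<le>m. ?e k)"
    using N by simp
  have moment: "(\<Sum>k\<le>m. (real m - 2 * real k) * ?d k) \<le> (\<Sum>k\<le>m. (real m - 2 * real k) * ?e k)"
    using moment_eq[OF D N m differ] moment_ge[OF E N m] by simp
  \<comment> \<open>The weight \<open>2 * (K + 1) - 2 * k\<close> is positive below
    \<open>K + 1\<close> and negative above it. Since \<open>m < 2 * (K + 1)\<close>, the total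
    enters with a positive coefficient and its inequality keeps its direction.\<close>
  have split: "(\<Sum>k\<le>m. (2 * (real K + 1) - 2 * real k) * f k) =
      (2 * (real K + 1) - real m) * (\<Sum>k\<le>m. f k) + (\<Sum>k\<le>m. (real m - 2 * real k) * f k)"
    for f :: "nat \<Rightarrow> real"
    by (simp add: sum_distrib_left algebra_simps flip: sum.distrib)
  have "(2 * (real K + 1) - real m) * (\<Sum>k\<le>m. ?d k) \<le> (2 * (real K + 1) - real m) * (\<Sum>k\<le>m. ?e k)"
    using total K by (intro mult_left_mono) auto
  then have comb: "(\<Sum>k\<le>m. (2 * (real K + 1) - 2 * real k) * ?d k) \<le>
      (\<Sum>k\<le>m. (2 * (real K + 1) - 2 * real k) * ?e k)"
    unfolding split using moment by (rule add_mono)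
  have "(\<Sum>k\<le>m. (2 * (real K + 1) - 2 * real k) * ?d k) =
     (\<Sum>k\<in>{0, K}. (2 * (real K + 1) - 2 * real k) * ?d k)"
  proof (rule sum.mono_neutral_right)
    show "\<forall>k\<in>{..m} - {0, K}. (2 * (real K + 1) - 2 * real k) * ?d k = 0"
    proof
      fix k assume "k \<in> {..m} - {0, K}"
      then show "(2 * (real K + 1) - 2 * real k) * ?d k = 0"
        using d0[of k] by (cases "k = K + 1") auto
    qed
  qed (use K in auto)
  also have "\<dots> = 2 * (real K + 1) + 2 * ?d K"
    using K wordlength_0[of D] N dims by simp
  finally have combd: "(\<Sum>k\<le>m. (2 * (real K + 1) - 2 * real k) * ?d k) = 2 * (real K + 1) + 2 * ?d K" .
  \<comment> \<open>Lengths beyond \<open>K + 1\<close> have negative weight, so moved to the left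
    they only strengthen the bound on \<open>?e K\<close>.\<close>
  have combe: "2 * ?d K + (\<Sum>k\<in>{K + 2..m}. 2 * (real k - real K - 1) * ?e k) \<le> 2 * ?e K"
    if low: "\<And>i. 1 \<le> i \<Longrightarrow> i < K \<Longrightarrow> ?e i = 0"
  proof -
    have "(\<Sum>k\<le>m. (2 * (real K + 1) - 2 * real k) * ?e k) =
       (\<Sum>k\<in>{0, K} \<union> {K + 2..m}. (2 * (real K + 1) - 2 * real k) * ?e k)"
    proof (rule sum.mono_neutral_right)
      show "\<forall>k\<in>{..m} - ({0, K} \<union> {K + 2..m}). (2 * (real K + 1) - 2 * real k) * ?e k = 0"
      proof
        fix k assume "k \<in> {..m} - ({0, K} \<union> {K + 2..m})"
        then consider "k = K + 1" | "1 \<le> k" "k < K" by force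
        then show "(2 * (real K + 1) - 2 * real k) * ?e k = 0"
          using low by cases auto
      qed
    qed (use K in auto)
    also have "\<dots> = (\<Sum>k\<in>{0, K}. (2 * (real K + 1) - 2 * real k) * ?e k) + 
       (\<Sum>k\<in>{K + 2..m}. (2 * (real K + 1) - 2 * real k) * ?e k)"
      by (rule sum.union_disjoint) auto
    also have "\<dots> = 2 * (real K + 1) + 2 * ?e K - (\<Sum>k\<in>{K + 2..m}. 2 * (real k - real K - 1) * ?e k)"
      unfolding diff_conv_add_uminus[of "2 * (real K + 1) + 2 * ?e K"] sum_negf[symmetric]
      by (intro arg_cong2[of _ _ _ _ "(+)"] sum.cong refl)
        (use K wordlength_0[of E] N dims in \<open>simp_all add: algebra_simps\<close>)
    finally show ?thesis using comb combd by simp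
  qed
  have tail: "0 \<le> 2 * (real k - real K - 1) * ?e k" if "k \<in> {K + 2..m}" for k
    using that nonneg by (intro mult_nonneg_nonneg) auto
  then have tail_sum: "0 \<le> (\<Sum>k\<in>{K + 2..m}. 2 * (real k - real K - 1) * ?e k)"
    by (rule sum_nonneg)
  have main: "?d j \<le> ?e j"
    if j: "1 \<le> j" "j \<le> m" and eq: "\<And>i. 1 \<le> i \<Longrightarrow> i < j \<Longrightarrow> ?d i = ?e i" for j
  proof -
    consider "j \<noteq> K" "j \<noteq> K + 1" | "j = K" | "j = K + 1" by blast
    then show ?thesis
    proof cases
      case 1
      then show ?thesis using d0 j nonneg by simp
    next
      case 2
      have low: "?e i = 0" if "1 \<le> i" "i < K" for i
        using eq[of i] d0[of i] that 2 by simp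
      show ?thesis
        using combe[OF low] tail_sum 2 by simp
    next
      case 3
      have low: "?e i = 0" if "1 \<le> i" "i < K" for i
        using eq[of i] d0[of i] that 3 by simp
      \<comment> \<open>Equality at length \<open>K\<close> leaves no room for words longer than
        \<open>K + 1\<close>, so the totals then compare the entries at \<open>K + 1\<close>
        alone.\<close>
      have "?e K = ?d K" using eq[of K] 3 K by simp
      then have "(\<Sum>k\<in>{K + 2..m}. 2 * (real k - real K - 1) * ?e k) \<le> 0"
        using combe[OF low] by simp
      then have "(\<Sum>k\<in>{K + 2..m}. 2 * (real k - real K - 1) * ?e k) = 0"
        using tail_sum by (rule order_antisym)
      then have "\<forall>k\<in>{K + 2..m}. 2 * (real k - real K - 1) * ?e k = 0"
        by (subst (asm) sum_nonneg_eq_0_iff) (use tail in auto)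
      then have high: "?e k = 0" if "k \<in> {K + 2..m}" for k
        using that by force
      have "(\<Sum>k\<le>m. ?e k) = (\<Sum>k\<in>{0, K, K + 1}. ?e k)"
      proof (rule sum.mono_neutral_right)
        show "\<forall>k\<in>{..m} - {0, K, K + 1}. ?e k = 0"
        proof
          fix k assume "k \<in> {..m} - {0, K, K + 1}"
          then consider "k \<in> {K + 2..m}" | "1 \<le> k" "k < K" by force
          then show "?e k = 0"
            using low high by cases auto
        qed
      qed (use j 3 in auto)
      moreover have "(\<Sum>k\<le>m. ?d k) = (\<Sum>k\<in>{0, K, K + 1}. ?d k)"
        using d0 j 3 by (intro sum.mono_neutral_right) auto
      ultimately show ?thesis
        using total K \<open>?e K = ?d K\<close> wordlength_0[of D] wordlength_0[of E] N dims 3 by simp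
    qed
  qed
  show "wordlength_pattern D = wordlength_pattern E \<or>
        (wordlength_pattern D, wordlength_pattern E) \<in> lexord {(x, y). x < y}"
    unfolding wordlength_pattern_def dims by (rule lexord_map_upt) (rule main)
qed

section \<open>Projectivity of quarter fractions\<close>

text \<open>Each choice of symbols in \<open>m - 2\<close> columns would occur exactly once, so that distinct runs
  would differ in at least 3 columns. Among the first \<open>m - 2\<close> columns, change the first or the second
  symbol of a run: both changes flip the last two columns, so the two new runs differ in only 2
  columns.\<close>

lemma not_has_projectivity_quarter:
  assumes E: "E \<in> two_level_designs N m" and m: "m \<ge> 4" "4 * N = 2 ^ m" and p: "m - 2 \<le> p" "p \<le> m"
  shows "\<not> has_projectivity E p"
proof
  assume proj: "has_projectivity E p"
  have dims: "dim_row E = N" "dim_col E = m"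
    using E by (auto simp: two_level_designs_def)
  have entry: "E $$ (i, c) = 1 \<or> E $$ (i, c) = -1" if "i < N" "c < m" for i c
    using two_level_designs_entry[OF E that] .
  have N: "N = 2 ^ (m - 2)"
  proof -
    obtain k where "m = 2 + k"
      using le_Suc_ex[of 2 m] m(1) by auto
    then show ?thesis
      using m(2) by (simp add: power_add)
  qed
  \<comment> \<open>Enlarge \<open>s\<close> to \<open>p\<close> columns and prescribe the arbitrary
    symbol 1 on the added ones.\<close>
  have all: "\<exists>i<N. \<forall>c\<in>s. E $$ (i, c) = x c"
    if s: "s \<subseteq> {..<m}" "card s = m - 2" "\<forall>c\<in>s. x c \<in> {1, -1}" for s x
  proof -
    have "\<exists>t. s \<subseteq> t \<and> t \<subseteq> {..<m} \<and> card t = p"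
      by (rule exists_subset_between) (use s p in simp_all)
    then obtain t where t: "s \<subseteq> t" "t \<subseteq> {..<m}" "card t = p"
      by blast
    define y where "y c = (if c \<in> s then x c else 1)" for c
    have "\<forall>c\<in>t. y c \<in> {1, -1}" using s(3) by (auto simp: y_def)
    then obtain i where "i < N" "\<forall>c\<in>t. E $$ (i, c) = y c"
      using proj t unfolding has_projectivity_def dims by blast
    then show ?thesis using t(1) by (intro exI[of _ i]) (auto simp: y_def subset_iff)
  qed
  \<comment> \<open>There are exactly \<open>N\<close> symbol choices on \<open>s\<close>, so the
    surjection from runs to choices is injective.\<close>
  have inj: "i = j"
    if ij: "i < N" "j < N" and s: "s \<subseteq> {..<m}" "card s = m - 2" "\<forall>c\<in>s. E $$ (i, c) = E $$ (j, c)" for s i j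
  proof -
    let ?f = "\<lambda>i. restrict (\<lambda>c. E $$ (i, c)) s"
    have fin: "finite s" using s(1) by (rule finite_subset) simp
    have "(\<Pi>\<^sub>E c\<in>s. {1, -1 :: int}) \<subseteq> ?f ` {..<N}"
    proof
      fix x assume x: "x \<in> (\<Pi>\<^sub>E c\<in>s. {1, -1 :: int})"
      then have "\<forall>c\<in>s. x c \<in> {1, -1}" by (auto simp: PiE_def)
      then obtain i where "i < N" "\<forall>c\<in>s. E $$ (i, c) = x c" using all[OF s(1,2)] by blast
      moreover have "x = ?f i" using x calculation by (intro extensionalityI[of _ s]) (auto simp: PiE_def)
      ultimately show "x \<in> ?f ` {..<N}" by blast
    qed
    then have "card (\<Pi>\<^sub>E c\<in>s. {1, -1 :: int}) \<le> card (?f ` {..<N})"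
      by (intro card_mono) auto
    moreover have "card (\<Pi>\<^sub>E c\<in>s. {1, -1 :: int}) = N"
      using fin s(2) N by (simp add: card_PiE numeral_2_eq_2)
    ultimately have "card (?f ` {..<N}) = card {..<N}"
      using card_image_le[of "{..<N}" ?f] by simp
    then have "inj_on ?f {..<N}" by (rule eq_card_imp_inj_on[rotated]) simp
    moreover have "?f i = ?f j" using s(3) by (auto simp: restrict_def)
    ultimately show ?thesis using ij by (auto dest: inj_onD)
  qed
  have far: "i = j" if "i < N" "j < N" "a < m" "b < m" "a \<noteq> b" 
    "\<forall>c<m. c \<noteq> a \<longrightarrow> c \<noteq> b \<longrightarrow> E $$ (i, c) = E $$ (j, c)" for i j a b
    by (rule inj[of i j "{..<m} - {a, b}"]) (use that in auto)
  have "0 < N" using N by simp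
  let ?S = "{..<m - 2}"
  have flip: "\<exists>i<N. \<forall>c<m - 2. E $$ (i, c) = (if c = a then - E $$ (0, c) else E $$ (0, c))" for a
  proof -
    have "\<forall>c\<in>?S. (if c = a then - E $$ (0, c) else E $$ (0, c)) \<in> {1, -1}"
    proof
      fix c assume "c \<in> ?S"
      then show "(if c = a then - E $$ (0, c) else E $$ (0, c)) \<in> {1, -1}"
        using entry[OF \<open>0 < N\<close>, of c] by auto
    qed
    then have "\<exists>i<N. \<forall>c\<in>?S. E $$ (i, c) = (if c = a then - E $$ (0, c) else E $$ (0, c))"
      by (rule all[rotated 2]) auto
    then show ?thesis
      by (simp only: Ball_def lessThan_iff)
  qed
  obtain i where i: "i < N" "\<forall>c<m - 2. E $$ (i, c) = (if c = 0 then - E $$ (0, c) else E $$ (0, c))"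
    using flip by blast
  obtain j where j: "j < N" "\<forall>c<m - 2. E $$ (j, c) = (if c = 1 then - E $$ (0, c) else E $$ (0, c))"
    using flip by blast
  have opp: "E $$ (k, d) = - E $$ (0, d)"
    if k: "k < N" "\<forall>c<m - 2. E $$ (k, c) = (if c = a then - E $$ (0, c) else E $$ (0, c))"
      and a: "a < 2" and d: "d = m - 2 \<or> d = m - 1" for k a d
  proof (rule ccontr)
    assume neq: "E $$ (k, d) \<noteq> - E $$ (0, d)"
    have "E $$ (k, d) = E $$ (0, d)"
      using neq entry[OF k(1), of d] entry[OF \<open>0 < N\<close>, of d] d m by auto
    \<comment> \<open>With column \<open>d\<close> unchanged, runs \<open>k\<close> and 0 could
      differ only in \<open>a\<close> and the other one of the last two columns, so
      \<open>far\<close> identifies them; but they do differ in \<open>a\<close>.\<close>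
    have "k = 0"
    proof (rule far[of k 0 a "if d = m - 2 then m - 1 else m - 2"])
      show "\<forall>c<m. c \<noteq> a \<longrightarrow> c \<noteq> (if d = m - 2 then m - 1 else m - 2) \<longrightarrow> E $$ (k, c) = E $$ (0, c)"
      proof (intro allI impI)
        fix c assume c: "c < m" "c \<noteq> a" "c \<noteq> (if d = m - 2 then m - 1 else m - 2)"
        then have "c < m - 2 \<or> c = d" using d by (auto split: if_splits)
        then show "E $$ (k, c) = E $$ (0, c)"
          using k(2) c \<open>E $$ (k, d) = E $$ (0, d)\<close> by auto
      qed
    qed (use k a m \<open>0 < N\<close> in auto)
    then have "E $$ (0, a) = - E $$ (0, a)" using k(2)[rule_format, of a] a m by simp
    then show False using entry[OF \<open>0 < N\<close>, of a] a m by auto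
  qed
  have "i = j"
  proof (rule far[of i j 0 1])
    show "\<forall>c<m. c \<noteq> 0 \<longrightarrow> c \<noteq> 1 \<longrightarrow> E $$ (i, c) = E $$ (j, c)"
    proof (intro allI impI)
      fix c assume c: "c < m" "c \<noteq> 0" "c \<noteq> 1"
      then consider "c < m - 2" | "c = m - 2 \<or> c = m - 1" by linarith
      then show "E $$ (i, c) = E $$ (j, c)"
        using i(2) j(2) c opp[OF i] opp[OF j] by cases auto
    qed
  qed (use i j m in auto)
  then have "- E $$ (0, 0) = E $$ (0, 0)" using i(2)[rule_format, of 0] j(2)[rule_format, of 0] m by simp
  then show False using entry[OF \<open>0 < N\<close>, of 0] m by auto
qed

text \<open>Every competitor is capped at \<open>m - 3\<close>, because
  \<open>not_has_projectivity_quarter\<close> rules out each \<open>p\<close> from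
  \<open>m - 2\<close> up to \<open>m\<close>.\<close>

lemma maximum_projectivity_quarterI:
  assumes D: "D \<in> two_level_designs N m" and m: "m \<ge> 4" "4 * N = 2 ^ m"
    and proj: "has_projectivity D (m - 3)"
  shows "maximum_projectivity N m D"
  unfolding maximum_projectivity_def
proof (intro conjI ballI D)
  fix E assume E: "E \<in> two_level_designs N m"
  have dims: "dim_col E = m" "dim_col D = m" "dim_row E = N"
    using D E by (auto simp: two_level_designs_def)
  have "N > 0" using m(2) by (cases N) auto
  \<comment> \<open>Projectivity 0 makes the set under \<open>Max\<close> nonempty.\<close>
  then have "has_projectivity E 0"
    using finite_subset[OF _ finite_lessThan, of _ m] dims
    by (auto simp: has_projectivity_def card_eq_0_iff)
  then have "projectivity E \<le> m - 3"
    unfolding projectivity_def dims using not_has_projectivity_quarter[OF E m]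
    by (subst Max_le_iff) (force simp: not_less_eq_eq)+
  also have "\<dots> \<le> projectivity D"
    unfolding projectivity_def dims using proj by (intro Max_ge) auto
  finally show "projectivity E \<le> projectivity D" .
qed

section \<open>Words of quaternary designs\<close>

lemma z4_cases: "(x :: 4) = 0 \<or> x = 1 \<or> x = 2 \<or> x = 3"
proof (cases x)
  case (of_int z)
  then have "z \<in> {0, 1, 2, 3}" by auto
  then show ?thesis using of_int(1) by auto
qed

lemma num_entries_eq_sum:
  assumes "v \<in> carrier_vec n"
  shows "num_entries v z = (\<Sum>i<n. of_bool (v $ i = z))"
proof -
  have "{..<n} \<inter> {i. v $ i = z} = {i. i < n \<and> v $ i = z}"
    by auto
  then show ?thesis
    using assms by (simp add: num_entries_def sum_of_bool_eq)
qed

lemma num_entries_sum: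
  assumes "v \<in> carrier_vec n"
  shows "num_entries v 0 + num_entries v 1 + num_entries v 2 + num_entries v 3 = n"
proof -
  have "num_entries v 0 + num_entries v 1 + num_entries v 2 + num_entries v 3 =
      (\<Sum>i<n. of_bool (v $ i = 0) + of_bool (v $ i = 1) + of_bool (v $ i = 2) + of_bool (v $ i = 3))"
    by (simp add: num_entries_eq_sum[OF assms] sum.distrib)
  also have "\<dots> = (\<Sum>i<n. 1)"
  proof (intro sum.cong refl)
    fix i
    show "of_bool (v $ i = 0) + of_bool (v $ i = 1) + of_bool (v $ i = 2) + of_bool (v $ i = 3) = (1 :: nat)"
      using z4_cases[of "v $ i"] by (elim disjE) auto
  qed
  finally show ?thesis by simp
qed

text \<open>Entry \<open>p\<close> of the codeword with coefficient vector \<open>u\<close>: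
  position 0 comes from \<open>v\<close>, every later position from column \<open>p - 1\<close> of
  the identity matrix.\<close>

definition coord :: "4 vec \<Rightarrow> 4 vec \<Rightarrow> nat \<Rightarrow> 4" where
  "coord v u p = (if p = 0 then \<Sum>i<dim_vec v. u $ i * v $ i else u $ (p - 1))"

definition symbol :: "4 \<Rightarrow> nat \<Rightarrow> int" where
  "symbol x c = (if even c then fst (gray x) else snd (gray x))"

section \<open>Runs as codewords, and the shape of nonvanishing words\<close>

context
  fixes n :: nat and v :: "4 vec"
  assumes v: "v \<in> carrier_vec n"
begin

private abbreviation (input) "Q \<equiv> quaternary_design v"
private abbreviation (input) "U \<equiv> row (all_coefficients n)"

private lemma dim_v: "dim_vec v = n"
  using v by simp

lemma quaternary_design_dims: "dim_row Q = 2 ^ (2 * n)" "dim_col Q = 2 * n + 2"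
  using quaternary_design_in_two_level_designs[OF v] by (auto simp: two_level_designs_def)

lemma quaternary_design_entry:
  assumes r: "r < 2 ^ (2 * n)" and c: "c < 2 * n + 2"
  shows "Q $$ (r, c) = symbol (coord v (U r) (c div 2)) c"
proof -
  have C: "code_matrix v $$ (r, p) = coord v (U r) p" if p: "p < n + 1" for p
  proof -
    have G: "dim_row (generator_matrix v) = n" "dim_col (generator_matrix v) = n + 1"
      using generator_matrix_carrier[of v] dim_v by auto
    have A: "dim_row (all_coefficients n) = 2 ^ (2 * n)" "dim_col (all_coefficients n) = n"
      unfolding all_coefficients_def by (rule dim_row_mat, rule dim_col_mat)
    have "code_matrix v $$ (r, p) = U r \<bullet> col (generator_matrix v) p"
      unfolding code_matrix_def dim_v using r p G A by (intro index_mult_mat) auto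
    also have "col (generator_matrix v) p = (v # cols (1\<^sub>m n)) ! p"
      unfolding generator_matrix_def dim_v using p v
      by (intro col_mat_of_cols) (auto simp: nth_Cons' intro: carrier_vecI)
    also have "U r \<bullet> (v # cols (1\<^sub>m n)) ! p = coord v (U r) p"
    proof (cases p)
      case 0
      then show ?thesis
        by (simp add: coord_def scalar_prod_def dim_v atLeast0LessThan)
    next
      case (Suc i)
      then have i: "i < n" using p by simp
      then have "(v # cols (1\<^sub>m n)) ! p = unit_vec n i"
        using Suc by simp
      moreover have "U r \<in> carrier_vec n" using A by (intro carrier_vecI) simp
      ultimately show ?thesis using i Suc by (simp add: coord_def)
    qed
    finally show ?thesis .
  qed
  have "dim_row (code_matrix v) = 2 ^ (2 * n)" "dim_col (code_matrix v) = n + 1"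
    using code_matrix_carrier[of v] dim_v by auto
  then show ?thesis
    using C[of "c div 2"] r c by (simp add: quaternary_design_def Let_def symbol_def)
qed

lemma obtain_run:
  assumes "u \<in> carrier_vec n"
  obtains r where "r < 2 ^ (2 * n)" "U r = u"
  using bij_betw_row_all_coefficients[of n] assms unfolding bij_betw_def by (metis imageE lessThan_iff)

text \<open>Summing over coefficient vectors instead of run indices makes translations of
  \<open>u\<close> available.\<close>

lemma word_sum_quaternary_design:
  assumes "s \<subseteq> {..<2 * n + 2}"
  shows "word_sum Q s = (\<Sum>u\<in>carrier_vec n. \<Prod>c\<in>s. symbol (coord v u (c div 2)) c)"
proof -
  have "word_sum Q s = (\<Sum>r\<in>{..<2 ^ (2 * n)}. \<Prod>c\<in>s. symbol (coord v (U r) (c div 2)) c)"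
    unfolding word_sum_def quaternary_design_dims
    using assms by (intro sum.cong prod.cong refl quaternary_design_entry) auto
  also have "\<dots> = (\<Sum>u\<in>carrier_vec n. \<Prod>c\<in>s. symbol (coord v u (c div 2)) c)"
    by (rule sum.reindex_bij_betw[OF bij_betw_row_all_coefficients])
  finally show ?thesis .
qed

text \<open>\<open>factor A B x\<close> is the contribution to a word of a pair of columns of which the first belongs
  to the word iff \<open>A\<close> and the second iff \<open>B\<close>.\<close>

definition factor :: "bool \<Rightarrow> bool \<Rightarrow> 4 \<Rightarrow> int" where
  "factor A B x = (if A then fst (gray x) else 1) * (if B then snd (gray x) else 1)"

lemma prod_word_factor:
  assumes "s \<subseteq> {..<2 * k}"
  shows "(\<Prod>c\<in>s. symbol (f (c div 2)) c) = (\<Prod>p<k. factor (2 * p \<in> s) (2 * p + 1 \<in> s) (f p))"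
proof -
  have "(\<Prod>c\<in>s. symbol (f (c div 2)) c) = (\<Prod>c<2 * k. if c \<in> s then symbol (f (c div 2)) c else 1)"
    using assms by (simp flip: prod.inter_restrict add: Int_absorb1)
  also have "\<dots> = (\<Prod>p<k. factor (2 * p \<in> s) (2 * p + 1 \<in> s) (f p))"
    by (induction k) (simp_all add: factor_def symbol_def mult.assoc)
  finally show ?thesis .
qed

lemma card_word:
  fixes s :: "nat set"
  assumes "s \<subseteq> {..<2 * k}"
  shows "card s = (\<Sum>p<k. of_bool (2 * p \<in> s) + of_bool (2 * p + 1 \<in> s))"
proof -
  have "card s = (\<Sum>c<2 * k. if c \<in> s then 1 else 0)"
    using assms by (simp flip: sum.inter_restrict add: Int_absorb1)
  also have "\<dots> = (\<Sum>p<k. of_bool (2 * p \<in> s) + of_bool (2 * p + 1 \<in> s))"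
    by (induction k) simp_all
  finally show ?thesis .
qed

private lemma prod_factor_pull:
  fixes f g :: "nat \<Rightarrow> int"
  assumes "i < n" "\<And>p. p < n \<Longrightarrow> p \<noteq> i \<Longrightarrow> f (Suc p) = g (Suc p)"
    "f 0 * f (Suc i) = - (g 0 * g (Suc i))"
  shows "(\<Prod>p<n + 1. f p) = - (\<Prod>p<n + 1. g p)"
proof -
  have split: "(\<Prod>p<n + 1. h p) = (h 0 * h (Suc i)) * (\<Prod>p\<in>{..<n} - {i}. h (Suc p))" for h :: "nat \<Rightarrow> int"
  proof -
    have "(\<Prod>p<n + 1. h p) = h 0 * (\<Prod>p<n. h (Suc p))"
      by (simp only: Suc_eq_plus1[symmetric] prod.lessThan_Suc_shift)
    also have "(\<Prod>p<n. h (Suc p)) = h (Suc i) * (\<Prod>p\<in>{..<n} - {i}. h (Suc p))"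
      using assms(1) by (simp add: prod.remove)
    finally show ?thesis by simp
  qed
  have "(\<Prod>p\<in>{..<n} - {i}. f (Suc p)) = (\<Prod>p\<in>{..<n} - {i}. g (Suc p))"
    by (intro prod.cong) (use assms(2) in auto)
  then show ?thesis unfolding split assms(3) by simp
qed

text \<open>Adding \<open>a\<close> to entry \<open>i\<close> of \<open>u\<close> permutes the
  coefficient vectors; it adds \<open>a * v $ i\<close> at codeword position 0, \<open>a\<close> at
  position \<open>Suc i\<close>, and nothing elsewhere. If this always negates the product, the word
  sum equals its own negative.\<close>

lemma word_sum_shift:
  assumes s: "s \<subseteq> {..<2 * n + 2}" and i: "i < n"
    and flip: "\<And>x y. factor (0 \<in> s) (1 \<in> s) (x + a * v $ i) * factor (2 * i + 2 \<in> s) (2 * i + 3 \<in> s) (y + a)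
      = - (factor (0 \<in> s) (1 \<in> s) x * factor (2 * i + 2 \<in> s) (2 * i + 3 \<in> s) y)"
  shows "word_sum Q s = 0"
proof -
  define g where "g u = (\<Prod>c\<in>s. symbol (coord v u (c div 2)) c)" for u
  define shift where "shift b u = (u + b \<cdot>\<^sub>v unit_vec n i :: 4 vec)" for b u
  have s': "s \<subseteq> {..<2 * (n + 1)}" using s by auto
  have g: "g u = (\<Prod>p<n + 1. factor (2 * p \<in> s) (2 * p + 1 \<in> s) (coord v u p))" for u
    unfolding g_def by (rule prod_word_factor[OF s'])
  have neg: "g (shift a u) = - g u" if u: "u \<in> carrier_vec n" for u
    unfolding g
  proof (rule prod_factor_pull[OF i])
    have co: "coord v (shift a u) (Suc p) = coord v u (Suc p) + (if p = i then a else 0)" if "p < n" for p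
      using that i u by (simp add: coord_def shift_def)
    have "(\<Sum>j<n. shift a u $ j * v $ j) = (\<Sum>j<n. u $ j * v $ j + (if j = i then a * v $ i else 0))"
      using i u by (intro sum.cong) (auto simp: shift_def algebra_simps)
    then have co0: "coord v (shift a u) 0 = coord v u 0 + a * v $ i"
      using i by (simp add: coord_def dim_v sum.distrib)
    show "factor (2 * Suc p \<in> s) (2 * Suc p + 1 \<in> s) (coord v (shift a u) (Suc p)) =
       factor (2 * Suc p \<in> s) (2 * Suc p + 1 \<in> s) (coord v u (Suc p))" if "p < n" "p \<noteq> i" for p
      using co that by simp
    have e: "2 * Suc i = 2 * i + 2" "2 * i + 2 + 1 = 2 * i + 3" by simp_all
    show "factor (2 * 0 \<in> s) (2 * 0 + 1 \<in> s) (coord v (shift a u) 0) *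
       factor (2 * Suc i \<in> s) (2 * Suc i + 1 \<in> s) (coord v (shift a u) (Suc i)) =
      - (factor (2 * 0 \<in> s) (2 * 0 + 1 \<in> s) (coord v u 0) *
         factor (2 * Suc i \<in> s) (2 * Suc i + 1 \<in> s) (coord v u (Suc i)))"
      unfolding co0 co[OF i] e using flip by simp
  qed
  have bij: "bij_betw (shift a) (carrier_vec n) (carrier_vec n)"
  proof (rule bij_betw_byWitness[where f' = "shift (- a)"])
    show "\<forall>u\<in>carrier_vec n. shift (- a) (shift a u) = u" "\<forall>u\<in>carrier_vec n. shift a (shift (- a) u) = u"
      by (auto simp: shift_def intro!: eq_vecI)
  qed (auto simp: shift_def)
  have "word_sum Q s = (\<Sum>u\<in>carrier_vec n. g u)"
    unfolding g_def by (rule word_sum_quaternary_design[OF s])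
  also have "\<dots> = (\<Sum>u\<in>carrier_vec n. g (shift a u))"
    by (rule sum.reindex_bij_betw[OF bij, symmetric])
  also have "\<dots> = - (\<Sum>u\<in>carrier_vec n. g u)"
    by (simp add: neg sum_negf)
  also have "(\<Sum>u\<in>carrier_vec n. g u) = word_sum Q s"
    unfolding g_def by (rule word_sum_quaternary_design[OF s, symmetric])
  finally show ?thesis by simp
qed

text \<open>Adding 2 negates both Gray symbols, so it flips the factor of a pair iff exactly one of
  its columns is in the word. Adding an odd residue negates the product of the two symbols, hence
  flips the factor of a pair wholly in the word. Neither the shift \<open>a = 2\<close> nor
  \<open>a = 1\<close> may negate a nonvanishing word, and \<open>v $ i\<close> decides what they
  add at position 0.\<close>

lemma word_structure:
  assumes s: "s \<subseteq> {..<2 * n + 2}" and i: "i < n" and nz: "word_sum Q s \<noteq> 0"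
  shows "v $ i = 0 \<Longrightarrow> 2 * i + 2 \<notin> s \<and> 2 * i + 3 \<notin> s"
    and "v $ i = 2 \<Longrightarrow> (2 * i + 2 \<in> s \<longleftrightarrow> ((0 \<in> s) \<noteq> (1 \<in> s))) \<and> (2 * i + 3 \<in> s \<longleftrightarrow> ((0 \<in> s) \<noteq> (1 \<in> s)))"
    and "v $ i = 1 \<or> v $ i = 3 \<Longrightarrow>
      (if (0 \<in> s) \<noteq> (1 \<in> s) then (2 * i + 2 \<in> s) \<noteq> (2 * i + 3 \<in> s)
       else (2 * i + 2 \<in> s \<longleftrightarrow> 0 \<in> s) \<and> (2 * i + 3 \<in> s \<longleftrightarrow> 0 \<in> s))"
proof -
  have f2: "factor A B (x + 2) = (if A \<noteq> B then - factor A B x else factor A B x)" for A B x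
    using z4_cases[of x] by (auto simp: factor_def gray_def)
  have z4: "(4 :: 4) = 0" "(6 :: 4) = 2"
    by simp_all
  have f1: "factor A A (x + 1) = (if A then - factor A A x else factor A A x)" for A x
    using z4_cases[of x] by (auto simp: factor_def gray_def)
  have f3: "factor A A (x + 3) = (if A then - factor A A x else factor A A x)" for A x
    using z4_cases[of x] by (auto simp: factor_def gray_def)
  define A B A' B' where def: "A = (0 \<in> s)" "B = (1 \<in> s)" "A' = (2 * i + 2 \<in> s)" "B' = (2 * i + 3 \<in> s)"
  have noflip: "\<not> (\<forall>x y. factor A B (x + a * v $ i) * factor A' B' (y + a) = - (factor A B x * factor A' B' y))" for a
    using word_sum_shift[OF s i, of a] nz unfolding def by blast
  show "v $ i = 0 \<Longrightarrow> 2 * i + 2 \<notin> s \<and> 2 * i + 3 \<notin> s"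
    using noflip[of 2] noflip[of 1] unfolding def[symmetric]
    by (cases A'; cases B') (auto simp: f2 f1 z4)
  show "v $ i = 2 \<Longrightarrow> (2 * i + 2 \<in> s \<longleftrightarrow> ((0 \<in> s) \<noteq> (1 \<in> s))) \<and> (2 * i + 3 \<in> s \<longleftrightarrow> ((0 \<in> s) \<noteq> (1 \<in> s)))"
    using noflip[of 2] noflip[of 1] unfolding def[symmetric]
    by (cases A'; cases B'; cases A; cases B) (auto simp: f2 f1 z4)
  show "v $ i = 1 \<or> v $ i = 3 \<Longrightarrow>
      (if (0 \<in> s) \<noteq> (1 \<in> s) then (2 * i + 2 \<in> s) \<noteq> (2 * i + 3 \<in> s)
       else (2 * i + 2 \<in> s \<longleftrightarrow> 0 \<in> s) \<and> (2 * i + 3 \<in> s \<longleftrightarrow> 0 \<in> s))"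
    using noflip[of 2] noflip[of 1] unfolding def[symmetric]
    by (cases A'; cases B'; cases A; cases B) (auto simp: f2 f1 f3 z4)
qed

text \<open>The two columns from \<open>v\<close> decide everything. If one of them is in the word,
  each odd entry contributes one column and each 2 contributes both; if both are, each odd entry
  contributes both and each 2 none; if neither is, no entry contributes.\<close>

lemma card_word_structure:
  assumes s: "s \<subseteq> {..<2 * n + 2}" and nz: "word_sum Q s \<noteq> 0"
  shows "(0 \<in> s) \<noteq> (1 \<in> s) \<Longrightarrow> card s = num_entries v 1 + num_entries v 3 + 1 + 2 * num_entries v 2"
    and "0 \<in> s \<Longrightarrow> 1 \<in> s \<Longrightarrow> card s = 2 * (num_entries v 1 + num_entries v 3 + 1)"
    and "0 \<notin> s \<Longrightarrow> 1 \<notin> s \<Longrightarrow> s = {}"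
proof -
  note count = num_entries_eq_sum[OF v]
  have card: "card s = of_bool (0 \<in> s) + of_bool (1 \<in> s) + (\<Sum>i<n. of_bool (2 * i + 2 \<in> s) + of_bool (2 * i + 3 \<in> s))"
    using card_word[of s "n + 1"] s unfolding Suc_eq_plus1[symmetric] sum.lessThan_Suc_shift
    by (simp add: numeral_3_eq_3)
  note st = word_structure[OF s _ nz]
  show "card s = num_entries v 1 + num_entries v 3 + 1 + 2 * num_entries v 2" if "(0 \<in> s) \<noteq> (1 \<in> s)"
  proof -
    have "of_bool (2 * i + 2 \<in> s) + of_bool (2 * i + 3 \<in> s) =
        of_bool (v $ i = 1) + of_bool (v $ i = 3) + 2 * (of_bool (v $ i = 2) :: nat)" if "i < n" for i
      using st[OF that] \<open>(0 \<in> s) \<noteq> (1 \<in> s)\<close> z4_cases[of "v $ i"] by (elim disjE) auto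
    then have "(\<Sum>i<n. of_bool (2 * i + 2 \<in> s) + of_bool (2 * i + 3 \<in> s)) =
        (\<Sum>i<n. of_bool (v $ i = 1) + of_bool (v $ i = 3) + 2 * (of_bool (v $ i = 2) :: nat))"
      by (intro sum.cong) auto
    then show ?thesis
      using that unfolding card count by (auto simp: sum.distrib sum_distrib_left)
  qed
  show "card s = 2 * (num_entries v 1 + num_entries v 3 + 1)" if "0 \<in> s" "1 \<in> s"
  proof -
    have "of_bool (2 * i + 2 \<in> s) + of_bool (2 * i + 3 \<in> s) =
        2 * (of_bool (v $ i = 1) + of_bool (v $ i = 3) :: nat)" if "i < n" for i
      using st[OF that] \<open>0 \<in> s\<close> \<open>1 \<in> s\<close> z4_cases[of "v $ i"] by (elim disjE) auto
    then have "(\<Sum>i<n. of_bool (2 * i + 2 \<in> s) + of_bool (2 * i + 3 \<in> s)) =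
        (\<Sum>i<n. 2 * (of_bool (v $ i = 1) + of_bool (v $ i = 3) :: nat))"
      by (intro sum.cong) auto
    then show ?thesis
      using that unfolding card count by (auto simp: sum.distrib sum_distrib_left)
  qed
  show "s = {}" if "0 \<notin> s" "1 \<notin> s"
  proof -
    have "of_bool (2 * i + 2 \<in> s) + of_bool (2 * i + 3 \<in> s) = (0 :: nat)" if "i < n" for i
      using st[OF that] \<open>0 \<notin> s\<close> \<open>1 \<notin> s\<close> z4_cases[of "v $ i"] by (elim disjE) auto
    then have "card s = 0"
      using that unfolding card by simp
    then show ?thesis
      using finite_subset[OF s] by simp
  qed
qed

text \<open>Used to tell when deleting a branching column shortens a word.\<close>

lemma word_associated_columns:
  assumes s: "s \<subseteq> {..<2 * n + 2}" and nz: "word_sum Q s \<noteq> 0"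
  shows "b \<in> associated_columns v 2 \<Longrightarrow> b \<in> s \<longleftrightarrow> (0 \<in> s) \<noteq> (1 \<in> s)"
    and "b \<in> associated_columns v 1 \<Longrightarrow> 0 \<in> s \<Longrightarrow> 1 \<in> s \<Longrightarrow> b \<in> s"
  using word_structure[OF s _ nz] unfolding associated_columns_def dim_v by auto

text \<open>The Gray map is injective, so runs agreeing off column \<open>b\<close> have codewords
  agreeing off position \<open>b div 2\<close>. If that position is \<open>Suc i\<close>, the
  partner column forces a difference that is 0 or odd, and position 0 forces the difference times
  \<open>v $ i\<close> to vanish. An odd residue is invertible, so \<open>v $ i \<noteq> 0\<close>
  leaves only 0.\<close>

lemma rows_differ_quaternary_design:
  assumes v0: "\<forall>i<n. v $ i \<noteq> 0"
  shows "rows_differ Q"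
  unfolding rows_differ_def quaternary_design_dims
proof (intro allI impI, rule ccontr)
  fix r t b assume rt: "r < 2 ^ (2 * n)" "t < 2 ^ (2 * n)" "r \<noteq> t" and b: "b < 2 * n + 2"
    and contra: "\<not> (\<exists>c<2 * n + 2. c \<noteq> b \<and> Q $$ (r, c) \<noteq> Q $$ (t, c))"
  let ?x = "coord v (U r)" and ?y = "coord v (U t)"
  have agree: "symbol (?x (c div 2)) c = symbol (?y (c div 2)) c" if "c < 2 * n + 2" "c \<noteq> b" for c
    using contra that rt by (metis quaternary_design_entry)
  have inj: "x = y" if "symbol x (2 * p) = symbol y (2 * p)" "symbol x (2 * p + 1) = symbol y (2 * p + 1)" for x y p
    using that z4_cases[of x] z4_cases[of y] by (auto simp: symbol_def gray_def)
  have off: "?x p = ?y p" if "p < n + 1" "p \<noteq> b div 2" for p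
    using that agree[of "2 * p"] agree[of "2 * p + 1"] by (intro inj[where p = p]) auto
  have U: "U r \<in> carrier_vec n" "U t \<in> carrier_vec n"
    by (intro carrier_vecI; simp add: all_coefficients_def)+
  have "U r = U t"
  proof (rule eq_vecI)
    fix i assume "i < dim_vec (U t)"
    then have i: "i < n" using carrier_vecD[OF U(2)] by simp
    show "U r $ i = U t $ i"
    proof (cases "Suc i = b div 2")
      case False
      then show ?thesis using off[of "Suc i"] i by (simp add: coord_def)
    next
      case True
      \<comment> \<open>The other column of the pair containing \<open>b\<close>.\<close>
      let ?c = "if even b then Suc b else b - 1"
      have "?c < 2 * n + 2" "?c \<noteq> b" "?c div 2 = Suc i"
        using True i b by (auto elim!: evenE oddE)
      then have 1: "symbol (U r $ i) ?c = symbol (U t $ i) ?c"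
        using agree[of ?c] by (simp add: coord_def)
      have "?x 0 = ?y 0" using off[of 0] True by simp
      then have "(\<Sum>j<n. (U r $ j - U t $ j) * v $ j) = 0"
        by (simp add: coord_def dim_v left_diff_distrib sum_subtractf)
      also have "(\<Sum>j<n. (U r $ j - U t $ j) * v $ j) = (\<Sum>j<n. if j = i then (U r $ i - U t $ i) * v $ i else 0)"
      proof (intro sum.cong refl)
        fix j assume "j \<in> {..<n}"
        then show "(U r $ j - U t $ j) * v $ j = (if j = i then (U r $ i - U t $ i) * v $ i else 0)"
          using off[of "Suc j"] True by (auto simp: coord_def)
      qed
      finally have "(U r $ i - U t $ i) * v $ i = 0"
        using i by simp
      moreover have "v $ i \<noteq> 0" using v0 i by simp
      ultimately show ?thesis
        using 1 z4_cases[of "U r $ i"] z4_cases[of "U t $ i"] z4_cases[of "v $ i"]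
        by (auto simp: symbol_def gray_def split: if_splits)
    qed
  qed (use U in auto)
  then show False
    using bij_betw_row_all_coefficients[of n] rt unfolding bij_betw_def by (auto dest: inj_onD)
qed
end

section \<open>Half-fractions\<close>

text \<open>\<open>I\<close> need not be bounded by \<open>m\<close>: \<open>- {b}\<close> is
  infinite, and the row set of a half-fraction also ranges over indices outside the matrix. In the
  relevant range \<open>pick I\<close> agrees with the strictly increasing enumeration of the
  bounded part, and counting turns injectivity into surjectivity.\<close>

lemma bij_betw_pick:
  "bij_betw (pick I) {..<card {a. a < m \<and> a \<in> I}} {a. a < m \<and> a \<in> I}"
proof -
  let ?S = "{a. a < m \<and> a \<in> I}"
  have red: "pick I i = pick ?S i" if "i < card ?S" for i
    using that by (rule pick_reduce_set)
  have "inj_on (pick I) {..<card ?S}"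
  proof (rule linorder_inj_onI')
    fix i j assume "i \<in> {..<card ?S}" "j \<in> {..<card ?S}" "i < j"
    then show "pick I i \<noteq> pick I j"
      using red pick_mono_le[of j ?S i] by simp
  qed
  moreover have "pick I ` {..<card ?S} \<subseteq> ?S"
    using red pick_in_set_le[of _ ?S] by fastforce
  ultimately show ?thesis
    unfolding bij_betw_def by (simp add: card_image card_subset_eq)
qed

context
  fixes D :: "int mat" and N m b :: nat and t :: int
  assumes D: "D \<in> two_level_designs (2 * N) (m + 1)" and b: "b < m + 1" and t: "t \<in> {1, -1}"
    and balanced: "word_sum D {b} = 0"
begin

private abbreviation (input) "H \<equiv> half_fraction D b t"
private abbreviation (input) "R \<equiv> {r. r < 2 * N \<and> D $$ (r, b) = t}"
private abbreviation (input) "I \<equiv> {r. D $$ (r, b) = t}"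
private abbreviation (input) "\<iota> \<equiv> pick (- {b})"

private lemma D_dims: "dim_row D = 2 * N" "dim_col D = m + 1"
  using D by (auto simp: two_level_designs_def)

text \<open>As \<open>t\<close> and the entries are signs, \<open>1 + t * D $$ (r, b)\<close> is
  twice the indicator of \<open>R\<close>.\<close>

private lemma sum_R: "2 * (\<Sum>r\<in>R. f r) = (\<Sum>r<2 * N. f r) + t * (\<Sum>r<2 * N. D $$ (r, b) * f r)"
proof -
  have "(\<Sum>r<2 * N. f r) + t * (\<Sum>r<2 * N. D $$ (r, b) * f r) =
      (\<Sum>r<2 * N. f r + t * (D $$ (r, b) * f r))"
    by (simp add: sum.distrib sum_distrib_left)
  also have "\<dots> = (\<Sum>r<2 * N. if r \<in> I then 2 * f r else 0)"
  proof (intro sum.cong refl)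
    fix r assume "r \<in> {..<2 * N}"
    then show "f r + t * (D $$ (r, b) * f r) = (if r \<in> I then 2 * f r else 0)"
      using two_level_designs_entry[OF D _ b, of r] t by auto
  qed
  also have "\<dots> = (\<Sum>r\<in>{..<2 * N} \<inter> I. 2 * f r)"
    by (simp add: sum.inter_restrict)
  also have "{..<2 * N} \<inter> I = R"
    by auto
  finally show ?thesis
    by (simp add: sum_distrib_left)
qed

private lemma card_R: "card R = N"
proof -
  have "(\<Sum>r<2 * N. D $$ (r, b)) = 0"
    using balanced by (simp add: word_sum_def D_dims)
  then have "2 * int (card R) = 2 * int N"
    using sum_R[of "\<lambda>_. 1"] by simp
  then show ?thesis by simp
qed

private lemma card_cols: "card {c. c < m + 1 \<and> c \<in> - {b}} = m"
proof -
  have "{c. c < m + 1 \<and> c \<in> - {b}} = {..<m + 1} - {b}" by auto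
  then show ?thesis using b by simp
qed

private lemma bij_rows: "bij_betw (pick I) {..<N} R"
  using bij_betw_pick[of I "2 * N"] by (simp add: card_R)

private lemma bij_cols: "bij_betw \<iota> {..<m} {c. c < m + 1 \<and> c \<noteq> b}"
  using bij_betw_pick[of "- {b}" "m + 1"] unfolding card_cols by simp

lemma half_fraction_dims: "dim_row H = N" "dim_col H = m"
  unfolding half_fraction_def dim_submatrix D_dims card_cols using card_R by simp_all

private lemma H_entry: "i < N \<Longrightarrow> c < m \<Longrightarrow> H $$ (i, c) = D $$ (pick I i, \<iota> c)"
  unfolding half_fraction_def by (rule submatrix_index) (simp_all only: D_dims card_cols card_R mem_Collect_eq)

private lemma pick_row: "i < N \<Longrightarrow> pick I i < 2 * N \<and> D $$ (pick I i, b) = t"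
  using bij_betwE[OF bij_rows] by auto

private lemma pick_col: "c < m \<Longrightarrow> \<iota> c < m + 1 \<and> \<iota> c \<noteq> b"
  using bij_betwE[OF bij_cols] by auto

private lemma obtain_col:
  assumes "c < m + 1" "c \<noteq> b"
  obtains c' where "c' < m" "\<iota> c' = c"
proof -
  have "c \<in> \<iota> ` {..<m}"
    unfolding bij_betw_imp_surj_on[OF bij_cols] using assms by simp
  then show thesis
    using that by auto
qed

private lemma obtain_row:
  assumes "r < 2 * N" "D $$ (r, b) = t"
  obtains i where "i < N" "pick I i = r"
proof -
  have "r \<in> pick I ` {..<N}"
    unfolding bij_betw_imp_surj_on[OF bij_rows] using assms by simp
  then show thesis
    using that by auto
qed

lemma half_fraction_in_two_level_designs: "H \<in> two_level_designs N m"
proof -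
  have "elements_mat H \<subseteq> {1, -1}"
  proof
    fix x assume "x \<in> elements_mat H"
    then obtain i c where "i < N" "c < m" "x = H $$ (i, c)"
      using elements_matD[of x H] half_fraction_dims by auto
    then show "x \<in> {1, -1}"
      using two_level_designs_entry[OF D, of "pick I i" "\<iota> c"] H_entry pick_row pick_col by auto
  qed
  moreover have "H \<in> carrier_mat N m"
    using half_fraction_dims by (intro carrier_matI)
  ultimately show ?thesis
    by (simp add: two_level_designs_def)
qed

text \<open>By \<open>sum_R\<close>, twice a word sum of the half-fraction is
  \<open>word_sum D w' + t * word_sum D (insert b w')\<close> for the corresponding columns
  \<open>w'\<close> of \<open>D\<close>, so one of these two terms is nonzero.\<close>

lemma half_fraction_word:
  assumes w: "w \<subseteq> {..<m}" and nz: "word_sum H w \<noteq> 0"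
  obtains w' where "w' \<subseteq> {..<m + 1}" "b \<notin> w'" "card w' = card w"
    "word_sum D w' \<noteq> 0 \<or> word_sum D (insert b w') \<noteq> 0"
proof -
  have inj: "inj_on \<iota> w"
    using bij_betw_imp_inj_on[OF bij_cols] w by (rule inj_on_subset)
  have w': "\<iota> ` w \<subseteq> {..<m + 1}" "b \<notin> \<iota> ` w"
    using w pick_col by (auto, metis lessThan_iff subsetD)
  have fin: "finite (\<iota> ` w)"
    using w'(1) by (rule finite_subset) simp
  have "word_sum H w = (\<Sum>i<N. \<Prod>c\<in>w. D $$ (pick I i, \<iota> c))"
    unfolding word_sum_def half_fraction_dims using w
    by (intro sum.cong prod.cong refl H_entry) auto
  also have "\<dots> = (\<Sum>i<N. \<Prod>c\<in>\<iota> ` w. D $$ (pick I i, c))"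
    by (simp add: prod.reindex[OF inj])
  also have "\<dots> = (\<Sum>r\<in>R. \<Prod>c\<in>\<iota> ` w. D $$ (r, c))"
    by (rule sum.reindex_bij_betw[OF bij_rows])
  finally have "2 * word_sum H w = word_sum D (\<iota> ` w) + t * word_sum D (insert b (\<iota> ` w))"
    using sum_R[of "\<lambda>r. \<Prod>c\<in>\<iota> ` w. D $$ (r, c)"] w'(2) fin by (simp add: word_sum_def D_dims)
  then have "word_sum D (\<iota> ` w) \<noteq> 0 \<or> word_sum D (insert b (\<iota> ` w)) \<noteq> 0"
    using nz by auto
  with w' card_image[OF inj] show thesis
    by (rule that)
qed

text \<open>All kept runs share the symbol in \<open>b\<close>, so a column distinguishing two of
  them survives the deletion.\<close>

lemma rows_differ_half_fraction:
  assumes "rows_differ D"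
  shows "rows_differ H"
  unfolding rows_differ_def half_fraction_dims
proof (intro allI impI)
  fix i j a assume ij: "i < N" "j < N" "i \<noteq> j" and a: "a < m"
  have "pick I i \<noteq> pick I j"
    using bij_betw_imp_inj_on[OF bij_rows] ij by (auto dest: inj_onD)
  then have "\<exists>c<m + 1. c \<noteq> \<iota> a \<and> D $$ (pick I i, c) \<noteq> D $$ (pick I j, c)"
    using assms pick_row[OF ij(1)] pick_row[OF ij(2)] pick_col[OF a]
    unfolding rows_differ_def D_dims by blast
  then obtain c where c: "c < m + 1" "c \<noteq> \<iota> a" "D $$ (pick I i, c) \<noteq> D $$ (pick I j, c)"
    by blast
  then have "c \<noteq> b"
    using pick_row[OF ij(1)] pick_row[OF ij(2)] by metis
  with c(1) obtain c' where "c' < m" "\<iota> c' = c"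
    by (rule obtain_col)
  then show "\<exists>c<m. c \<noteq> a \<and> H $$ (i, c) \<noteq> H $$ (j, c)"
    using c ij H_entry by (intro exI[of _ c']) auto
qed

text \<open>Prescribing \<open>t\<close> in column \<open>b\<close> uses up one of the
  \<open>Suc p\<close> columns and selects a run that is kept.\<close>

lemma has_projectivity_half_fraction:
  assumes proj: "has_projectivity D (Suc p)"
  shows "has_projectivity H p"
  unfolding has_projectivity_def half_fraction_dims
proof (intro allI impI)
  fix s x assume s: "s \<subseteq> {..<m}" "card s = p" and x: "\<forall>c\<in>s. x c \<in> {1, -1 :: int}"
  have inj: "inj_on \<iota> s"
    using bij_betw_imp_inj_on[OF bij_cols] s(1) by (rule inj_on_subset)
  have s': "\<iota> ` s \<subseteq> {..<m + 1}" "b \<notin> \<iota> ` s"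
    using s pick_col by (auto, metis lessThan_iff subsetD)
  have fin: "finite (\<iota> ` s)"
    using s'(1) by (rule finite_subset) simp
  define y where "y c = (if c = b then t else x (the_inv_into s \<iota> c))" for c
  have y: "y (\<iota> c) = x c" if "c \<in> s" for c
  proof -
    have "\<iota> c \<noteq> b"
      using that s'(2) by (metis imageI)
    then show ?thesis
      using that inj by (simp add: y_def the_inv_into_f_f)
  qed
  have "\<exists>r<2 * N. \<forall>c\<in>insert b (\<iota> ` s). D $$ (r, c) = y c"
  proof -
    have "insert b (\<iota> ` s) \<subseteq> {..<dim_col D}" "card (insert b (\<iota> ` s)) = Suc p"
      using s' b fin s card_image[OF inj] by (simp_all add: D_dims)
    moreover have "\<forall>c\<in>insert b (\<iota> ` s). y c \<in> {1, -1}"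
      using t x y by (auto simp: y_def)
    ultimately show ?thesis
      using proj unfolding has_projectivity_def D_dims by blast
  qed
  then obtain r where r: "r < 2 * N" "D $$ (r, b) = y b" "\<forall>c\<in>s. D $$ (r, \<iota> c) = x c"
    using y by auto
  then have "D $$ (r, b) = t"
    by (simp add: y_def)
  with r(1) obtain i where i: "i < N" "pick I i = r"
    by (rule obtain_row)
  then show "\<exists>i<N. \<forall>c\<in>s. H $$ (i, c) = x c"
    using r(3) s(1) H_entry by (intro exI[of _ i]) auto
qed

end

section \<open>Projectivity of quaternary designs\<close>

lemma z4_ex: "(\<exists>x :: 4. P x) \<longleftrightarrow> P 0 \<or> P 1 \<or> P 2 \<or> P 3"
  using z4_cases by metis

text \<open>If \<open>\<kappa>\<close> is odd, it is invertible and \<open>z\<close> alone suffices.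
  If it is 2, then \<open>\<nu>\<close> is odd: \<open>e\<close> fixes the parity and
  \<open>z\<close> the rest.\<close>

lemma z4_solve_pair:
  fixes \<kappa> \<nu> d :: 4
  assumes "\<kappa> \<noteq> 0" "\<nu> \<noteq> 0" "\<not> (\<kappa> = 2 \<and> \<nu> = 2)"
  shows "\<exists>z. \<exists>e\<in>{0, 1}. \<kappa> * z + \<nu> * e = d"
  unfolding z4_ex using assms z4_cases[of \<kappa>] z4_cases[of \<nu>] z4_cases[of d]
  by (elim disjE; simp)

text \<open>Odd coefficients are 1 or -1, so the subset sums of three of them cover four consecutive
  residues. With one coefficient 2, the two odd ones give three consecutive residues and adding 2
  reaches the fourth.\<close>

lemma z4_solve_triple:
  fixes \<kappa> \<nu> \<mu> d :: 4
  assumes "\<kappa> \<noteq> 0" "\<nu> \<noteq> 0" "\<mu> \<noteq> 0"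
    "\<not> (\<kappa> = 2 \<and> \<nu> = 2)" "\<not> (\<kappa> = 2 \<and> \<mu> = 2)" "\<not> (\<nu> = 2 \<and> \<mu> = 2)"
  shows "\<exists>e\<in>{0, 1}. \<exists>f\<in>{0, 1}. \<exists>g\<in>{0, 1}. \<kappa> * e + \<nu> * f + \<mu> * g = d"
  using assms z4_cases[of \<kappa>] z4_cases[of \<nu>] z4_cases[of \<mu>] z4_cases[of d]
  by (elim disjE; simp)

text \<open>The three columns of \<open>M\<close> free either a whole pair and half of another, or
  half of each of three pairs. A whole free pair takes any value, half a pair two consecutive ones;
  \<open>z4_solve_pair\<close> and \<open>z4_solve_triple\<close> then adjust the sum.\<close>

lemma solve_linear_equation:
  fixes \<kappa> :: "nat \<Rightarrow> 4" and x :: "nat \<Rightarrow> int"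
  assumes nz: "\<And>p. p < k \<Longrightarrow> \<kappa> p \<noteq> 0"
    and one: "\<And>p q. p < k \<Longrightarrow> q < k \<Longrightarrow> \<kappa> p = 2 \<Longrightarrow> \<kappa> q = 2 \<Longrightarrow> p = q"
    and M: "M \<subseteq> {..<2 * k}" "card M = 3"
    and x: "\<And>c. c < 2 * k \<Longrightarrow> c \<notin> M \<Longrightarrow> x c \<in> {1, -1}"
  shows "\<exists>y. (\<Sum>p<k. \<kappa> p * y p) = 0 \<and> (\<forall>c<2 * k. c \<notin> M \<longrightarrow> symbol (y (c div 2)) c = x c)"
proof -
  define ok where "ok p z \<longleftrightarrow> (2 * p \<notin> M \<longrightarrow> symbol z (2 * p) = x (2 * p)) \<and>
    (2 * p + 1 \<notin> M \<longrightarrow> symbol z (2 * p + 1) = x (2 * p + 1))" for p z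
  have ex: "\<exists>z. ok p z" if "p < k" for p
    using x[of "2 * p"] x[of "2 * p + 1"] that unfolding ok_def z4_ex
    by (auto simp: symbol_def gray_def)
  \<comment> \<open>The two residues with a given Gray symbol in one column of a pair are cyclically
    consecutive.\<close>
  have single: "\<exists>\<alpha>. ok p \<alpha> \<and> ok p (\<alpha> + 1)" if "p < k" "2 * p \<in> M \<or> 2 * p + 1 \<in> M" for p
    using x[of "2 * p"] x[of "2 * p + 1"] that unfolding ok_def z4_ex
    by (auto simp: symbol_def gray_def)
  have full: "ok p z" if "2 * p \<in> M" "2 * p + 1 \<in> M" for p z
    using that by (simp add: ok_def)
  \<comment> \<open>Pairs outside \<open>P\<close> take any admissible values, and those in
    \<open>P\<close> compensate for their sum.\<close>
  have glue: ?thesis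
    if P: "P \<subseteq> {..<k}" and local: "\<And>d. \<exists>y. (\<forall>p\<in>P. ok p (y p)) \<and> (\<Sum>p\<in>P. \<kappa> p * y p) = d" for P
  proof -
    obtain y0 where y0: "\<And>p. p < k \<Longrightarrow> ok p (y0 p)"
      using ex by metis
    obtain y1 where y1: "\<And>p. p \<in> P \<Longrightarrow> ok p (y1 p)"
      "(\<Sum>p\<in>P. \<kappa> p * y1 p) = - (\<Sum>p\<in>{..<k} - P. \<kappa> p * y0 p)"
      using local by blast
    define y where "y p = (if p \<in> P then y1 p else y0 p)" for p
    have "(\<Sum>p<k. \<kappa> p * y p) = (\<Sum>p\<in>{..<k} - P. \<kappa> p * y p) + (\<Sum>p\<in>P. \<kappa> p * y p)"
      using P by (intro sum.subset_diff) auto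
    also have "\<dots> = 0"
      using y1(2) by (simp add: y_def cong: sum.cong_simp)
    finally have "(\<Sum>p<k. \<kappa> p * y p) = 0" .
    moreover have "symbol (y (c div 2)) c = x c" if "c < 2 * k" "c \<notin> M" for c
    proof -
      have "ok (c div 2) (y (c div 2))"
        using y0[of "c div 2"] y1(1) that by (auto simp: y_def)
      then show ?thesis
        using that unfolding ok_def by (cases "even c") (auto elim!: evenE oddE)
    qed
    ultimately show ?thesis by blast
  qed
  have pair: ?thesis
    if pq: "p < k" "q < k" "p \<noteq> q" and Mpq: "2 * p \<in> M" "2 * p + 1 \<in> M" "2 * q \<in> M \<or> 2 * q + 1 \<in> M" for p q
  proof (rule glue[of "{p, q}"])
    fix d
    obtain \<alpha> where \<alpha>: "ok q \<alpha>" "ok q (\<alpha> + 1)"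
      using single[OF pq(2) Mpq(3)] by blast
    obtain z e where ze: "e \<in> {0, 1}" "\<kappa> p * z + \<kappa> q * e = d - \<kappa> q * \<alpha>"
      using z4_solve_pair[OF nz[OF pq(1)] nz[OF pq(2)]] one[OF pq(1,2)] pq(3) by blast
    have "\<kappa> p * z + \<kappa> q * (\<alpha> + e) = d"
      using ze(2) by (simp add: algebra_simps)
    moreover have "ok q (\<alpha> + e)" using \<alpha> ze(1) by auto
    ultimately show "\<exists>y. (\<forall>i\<in>{p, q}. ok i (y i)) \<and> (\<Sum>i\<in>{p, q}. \<kappa> i * y i) = d"
      using full[of p z] pq Mpq by (intro exI[of _ "(\<lambda>_. \<alpha> + e)(p := z)"]) auto
  qed (use pq in auto)
  have triple: ?thesis
    if pqr: "p < k" "q < k" "r < k" "p \<noteq> q" "p \<noteq> r" "q \<noteq> r" and Mpqr: "2 * p \<in> M \<or> 2 * p + 1 \<in> M"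
      "2 * q \<in> M \<or> 2 * q + 1 \<in> M" "2 * r \<in> M \<or> 2 * r + 1 \<in> M" for p q r
  proof (rule glue[of "{p, q, r}"])
    fix d
    obtain \<alpha> \<beta> \<gamma> where ok: "ok p \<alpha>" "ok p (\<alpha> + 1)" "ok q \<beta>" "ok q (\<beta> + 1)" "ok r \<gamma>" "ok r (\<gamma> + 1)"
      using single[OF pqr(1) Mpqr(1)] single[OF pqr(2) Mpqr(2)] single[OF pqr(3) Mpqr(3)] by blast
    have "\<not> (\<kappa> p = 2 \<and> \<kappa> q = 2)" "\<not> (\<kappa> p = 2 \<and> \<kappa> r = 2)" "\<not> (\<kappa> q = 2 \<and> \<kappa> r = 2)"
      using one[OF pqr(1,2)] one[OF pqr(1,3)] one[OF pqr(2,3)] pqr(4-6) by blast+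
    then have "\<exists>e\<in>{0, 1}. \<exists>f\<in>{0, 1}. \<exists>g\<in>{0, 1}.
        \<kappa> p * e + \<kappa> q * f + \<kappa> r * g = d - \<kappa> p * \<alpha> - \<kappa> q * \<beta> - \<kappa> r * \<gamma>"
      by (rule z4_solve_triple[OF nz[OF pqr(1)] nz[OF pqr(2)] nz[OF pqr(3)]])
    then obtain e f g where efg: "e \<in> {0, 1}" "f \<in> {0, 1}" "g \<in> {0, 1}"
      "\<kappa> p * e + \<kappa> q * f + \<kappa> r * g = d - \<kappa> p * \<alpha> - \<kappa> q * \<beta> - \<kappa> r * \<gamma>"
      by blast
    have "\<kappa> p * (\<alpha> + e) + (\<kappa> q * (\<beta> + f) + \<kappa> r * (\<gamma> + g)) = d"
      using efg(4) by (simp add: algebra_simps)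
    moreover have "ok p (\<alpha> + e)" "ok q (\<beta> + f)" "ok r (\<gamma> + g)" using ok efg(1-3) by auto
    ultimately show "\<exists>y. (\<forall>i\<in>{p, q, r}. ok i (y i)) \<and> (\<Sum>i\<in>{p, q, r}. \<kappa> i * y i) = d"
      using pqr by (intro exI[of _ "(\<lambda>_. \<gamma> + g)(p := \<alpha> + e, q := \<beta> + f)"]) auto
  qed (use pqr in auto)
  have same: "2 * (a div 2) \<in> M \<and> 2 * (a div 2) + 1 \<in> M" if "a \<in> M" "b \<in> M" "a \<noteq> b" "a div 2 = b div 2" for a b
  proof -
    have "{a, b} = {2 * (a div 2), 2 * (a div 2) + 1}"
      using that(3,4) by (auto simp: doubleton_eq_iff)
    then show ?thesis using that(1,2) by (auto simp: doubleton_eq_iff)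
  qed
  have mem: "2 * (a div 2) \<in> M \<or> 2 * (a div 2) + 1 \<in> M" "a div 2 < k" if "a \<in> M" for a
    using that M(1) by (cases "even a"; auto)+
  have full_single: ?thesis
    if "a \<in> M" "b \<in> M" "c \<in> M" "a \<noteq> b" "a \<noteq> c" "b \<noteq> c" "a div 2 = b div 2" for a b c
  proof (rule pair[of "a div 2" "c div 2"])
    \<comment> \<open>A pair has only two columns, so the third element of \<open>M\<close> lies in
      another pair.\<close>
    show "a div 2 \<noteq> c div 2"
    proof
      assume eq: "a div 2 = c div 2"
      have "x \<in> {2 * (x div 2), 2 * (x div 2) + 1}" for x :: nat
        by (cases "even x") auto
      from this[of a] this[of b] this[of c]
      have "a \<in> {2 * (a div 2), 2 * (a div 2) + 1}" "b \<in> {2 * (a div 2), 2 * (a div 2) + 1}"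
        "c \<in> {2 * (a div 2), 2 * (a div 2) + 1}"
        by (simp_all only: that(7)[symmetric] eq[symmetric])
      then show False
        using that(4-6) by blast
    qed
  qed (use same[OF that(1,2,4,7)] mem[OF that(1)] mem[OF that(3)] in simp_all)
  obtain a b c where abc: "M = {a, b, c}" "a \<noteq> b" "a \<noteq> c" "b \<noteq> c"
    using M(2) unfolding card_3_iff by auto
  consider "a div 2 = b div 2" | "a div 2 = c div 2" | "b div 2 = c div 2" |
    "a div 2 \<noteq> b div 2" "a div 2 \<noteq> c div 2" "b div 2 \<noteq> c div 2" by blast
  then show ?thesis
  proof cases
    case 1 then show ?thesis using full_single[of a b c] abc by simp
  next
    case 2 then show ?thesis using full_single[of a c b] abc by simp
  next
    case 3 then show ?thesis using full_single[of b c a] abc by simp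
  next
    case 4 then show ?thesis
      using triple[of "a div 2" "b div 2" "c div 2"] mem abc by simp
  qed
qed

text \<open>The codewords solve a linear equation with coefficient -1 at position 0 and the entries
  of \<open>v\<close> elsewhere; -1 is neither 0 nor 2, so at most one coefficient is 2. Prescribing
  \<open>2 * n - 1\<close> columns leaves three free.\<close>

lemma has_projectivity_quaternary_design:
  assumes v: "v \<in> carrier_vec n" and n: "n \<ge> 1" and v0: "\<forall>i<n. v $ i \<noteq> 0" and v2: "num_entries v 2 \<le> 1"
  shows "has_projectivity (quaternary_design v) (2 * n - 1)"
  unfolding has_projectivity_def quaternary_design_dims[OF v]
proof (intro allI impI)
  fix s x assume s: "s \<subseteq> {..<2 * n + 2}" "card s = 2 * n - 1" and x: "\<forall>c\<in>s. x c \<in> {1, -1 :: int}"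
  let ?M = "{..<2 * n + 2} - s"
  let ?\<kappa> = "\<lambda>p. if p = 0 then -1 else v $ (p - 1)"
  have "\<exists>y. (\<Sum>p<n + 1. ?\<kappa> p * y p) = 0 \<and> (\<forall>c<2 * (n + 1). c \<notin> ?M \<longrightarrow> symbol (y (c div 2)) c = x c)"
  proof (rule solve_linear_equation)
    show "?\<kappa> p \<noteq> 0" if "p < n + 1" for p
      using that v0 by auto
    show "p = q" if pq: "p < n + 1" "q < n + 1" "?\<kappa> p = 2" "?\<kappa> q = 2" for p q
    proof -
      have "p \<noteq> 0" "q \<noteq> 0" using pq by (auto split: if_splits)
      moreover have "p - 1 = q - 1"
        using v2 pq calculation v unfolding num_entries_def
        by (auto simp: card_le_Suc0_iff_eq)
      ultimately show ?thesis by simp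
    qed
    show "card ?M = 3"
      using s n finite_subset[OF s(1)] by (simp add: card_Diff_subset)
  qed (use s x in auto)
  then obtain y where y: "(\<Sum>p<n + 1. ?\<kappa> p * y p) = 0" "\<And>c. c \<in> s \<Longrightarrow> symbol (y (c div 2)) c = x c"
    using s by auto
  define u where "u = vec n (\<lambda>i. y (Suc i))"
  have "(\<Sum>i<n. v $ i * y (Suc i)) = y 0"
    using y(1) unfolding Suc_eq_plus1[symmetric] sum.lessThan_Suc_shift by simp
  then have coord: "coord v u p = y p" if "p < n + 1" for p
    using that v by (auto simp: coord_def u_def mult.commute)
  obtain r where r: "r < 2 ^ (2 * n)" "row (all_coefficients n) r = u"
    using obtain_run[OF v, of u] by (auto simp: u_def)
  have "quaternary_design v $$ (r, c) = x c" if "c \<in> s" for c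
  proof -
    have c: "c < 2 * n + 2" using that s by auto
    then show ?thesis
      using quaternary_design_entry[OF v r(1) c] r(2) coord[of "c div 2"] y(2)[OF that] by simp
  qed
  then show "\<exists>r<2 ^ (2 * n). \<forall>c\<in>s. quaternary_design v $$ (r, c) = x c"
    using r(1) by blast
qed

lemma num_entries_0_imp:
  assumes "num_entries v 0 = 0"
  shows "\<forall>i<dim_vec v. v $ i \<noteq> 0"
  using assms by (auto simp: num_entries_def)

section \<open>Optimality of quaternary designs\<close>

context
  fixes n :: nat and v :: "4 vec"
  assumes v: "v \<in> carrier_vec n" and n: "n \<ge> 1"
begin

private abbreviation (input) "QD \<equiv> quaternary_design v"
private abbreviation (input) "odd_entries \<equiv> num_entries v 1 + num_entries v 3"

lemma nonzero_entries:
  assumes "odd_entries + num_entries v 2 = n"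
  shows "\<forall>i<n. v $ i \<noteq> 0"
  using num_entries_sum[OF v] assms num_entries_0_imp[of v] v by simp

text \<open>\<open>n < K\<close> is the condition \<open>m < 2 * (K + 1)\<close> of the criterion
  for \<open>m = 2 * n + 2\<close>.\<close>

lemma minimum_aberration_quaternary_design:
  assumes full: "odd_entries + num_entries v 2 = n"
    and K: "1 \<le> K" "n < K" "K \<le> 2 * n + 2"
    and words: "odd_entries + 1 + 2 * num_entries v 2 \<in> {K, K + 1}" "2 * (odd_entries + 1) \<in> {K, K + 1}"
  shows "minimum_aberration (2 ^ (2 * n)) (2 * n + 2) QD"
proof (rule minimum_aberration_criterion[of _ _ _ K])
  show "QD \<in> two_level_designs (2 ^ (2 * n)) (2 * n + 2)"
    by (rule quaternary_design_in_two_level_designs[OF v])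
  show "rows_differ QD"
    by (rule rows_differ_quaternary_design[OF v nonzero_entries[OF full]])
  show "s = {} \<or> card s = K \<or> card s = K + 1" if "s \<subseteq> {..<2 * n + 2}" "word_sum QD s \<noteq> 0" for s
    using card_word_structure[OF v that] words by (cases "0 \<in> s"; cases "1 \<in> s"; simp)
qed (use K in auto)

lemma quaternary_design_as_double:
  "QD \<in> two_level_designs (2 * 2 ^ (2 * n - 1)) (2 * n + 1 + 1)"
proof -
  have "2 * 2 ^ (2 * n - 1) = (2 :: nat) ^ (2 * n)"
    using n by (simp flip: power_Suc)
  then show ?thesis
    using quaternary_design_in_two_level_designs[OF v] by simp
qed

text \<open>A nonvanishing word \<open>{b}\<close> would contain exactly one of the columns 0 and 1,
  making it longer than 1, or neither, making it empty.\<close>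

lemma balanced_column:
  assumes "odd_entries + num_entries v 2 \<noteq> 0" "b < 2 * n + 2"
  shows "word_sum QD {b} = 0"
proof (rule ccontr)
  assume nz: "word_sum QD {b} \<noteq> 0"
  have b: "{b} \<subseteq> {..<2 * n + 2}"
    using assms(2) by simp
  show False
    using card_word_structure[OF v b nz] assms(1) by (cases "b = 0"; cases "b = 1"; simp)
qed

text \<open>Nonvanishing words of the half-fraction come from those of the design by removing
  \<open>b\<close>; with only \<open>2 * n + 1\<close> columns, \<open>n \<le> K\<close>
  suffices.\<close>

lemma minimum_aberration_half_fraction:
  assumes full: "odd_entries + num_entries v 2 = n"
    and b: "b < 2 * n + 2" and t: "t \<in> {1, -1}"
    and K: "1 \<le> K" "n \<le> K" "K \<le> 2 * n + 1"
    and words: "\<And>s. s \<subseteq> {..<2 * n + 2} \<Longrightarrow> word_sum QD s \<noteq> 0 \<Longrightarrow> s \<noteq> {} \<Longrightarrow>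
      card (s - {b}) \<in> {K, K + 1}"
  shows "minimum_aberration (2 ^ (2 * n - 1)) (2 * n + 1) (half_fraction QD b t)"
proof (rule minimum_aberration_criterion[of _ _ _ K])
  let ?H = "half_fraction QD b t"
  have b': "b < 2 * n + 1 + 1" using b by simp
  have "word_sum QD {b} = 0"
    using balanced_column b full n by simp
  note half = quaternary_design_as_double b' t this
  show "?H \<in> two_level_designs (2 ^ (2 * n - 1)) (2 * n + 1)"
    by (rule half_fraction_in_two_level_designs[OF half])
  show "rows_differ ?H"
    by (rule rows_differ_half_fraction[OF half rows_differ_quaternary_design[OF v nonzero_entries[OF full]]])
  show "w = {} \<or> card w = K \<or> card w = K + 1" if w: "w \<subseteq> {..<2 * n + 1}" "word_sum ?H w \<noteq> 0" for w
  proof -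
    obtain w' where w': "w' \<subseteq> {..<2 * n + 1 + 1}" "b \<notin> w'" "card w' = card w"
      "word_sum QD w' \<noteq> 0 \<or> word_sum QD (insert b w') \<noteq> 0"
      using half_fraction_word[OF half w] by blast
    have fin: "finite w'" "finite w"
      using w'(1) w(1) by (auto intro: finite_subset)
    consider "w' = {}" | "word_sum QD w' \<noteq> 0" "w' \<noteq> {}" | "word_sum QD (insert b w') \<noteq> 0"
      using w'(4) by blast
    then show ?thesis
    proof cases
      case 1
      then show ?thesis using w'(3) fin by simp
    next
      case 2
      then show ?thesis
        using words[of w'] w' by simp
    next
      case 3
      then show ?thesis
        using words[of "insert b w'"] w' b by simp
    qed
  qed
qed (use K in auto)

lemma associated_columns_less: "b \<in> associated_columns v z \<Longrightarrow> b < 2 * n + 2"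
  using v by (auto simp: associated_columns_def)

text \<open>If \<open>b\<close> is associated with 2, it lies in precisely the words with exactly
  one of the columns 0 and 1. If associated with 1, it lies in every word with both, and may or may
  not lie in the others.\<close>

lemma card_word_minus:
  assumes s: "s \<subseteq> {..<2 * n + 2}" and nz: "word_sum QD s \<noteq> 0" "s \<noteq> {}"
  shows "b \<in> associated_columns v 2 \<Longrightarrow>
      card (s - {b}) \<in> {odd_entries + 2 * num_entries v 2, 2 * (odd_entries + 1)}"
    and "b \<in> associated_columns v 1 \<Longrightarrow>
      card (s - {b}) \<in> {odd_entries + 2 * num_entries v 2, odd_entries + 2 * num_entries v 2 + 1, 2 * odd_entries + 1}"
proof -
  have fin: "finite s"
    using s by (rule finite_subset) simp
  consider "(0 \<in> s) \<noteq> (1 \<in> s)" | "0 \<in> s" "1 \<in> s"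
    using card_word_structure(3)[OF v s nz(1)] nz(2) by blast
  note types = this
  show "card (s - {b}) \<in> {odd_entries + 2 * num_entries v 2, 2 * (odd_entries + 1)}"
    if "b \<in> associated_columns v 2"
    using types
  proof cases
    case 1
    then show ?thesis
      using card_word_structure(1)[OF v s nz(1)] word_associated_columns(1)[OF v s nz(1) that] fin by simp
  next
    case 2
    then show ?thesis
      using card_word_structure(2)[OF v s nz(1)] word_associated_columns(1)[OF v s nz(1) that] by simp
  qed
  show "card (s - {b}) \<in> {odd_entries + 2 * num_entries v 2, odd_entries + 2 * num_entries v 2 + 1, 2 * odd_entries + 1}"
    if "b \<in> associated_columns v 1"
    using types
  proof cases
    case 1
    then show ?thesis
      using card_word_structure(1)[OF v s nz(1)] fin by (cases "b \<in> s") simp_all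
  next
    case 2
    then show ?thesis
      using card_word_structure(2)[OF v s nz(1)] word_associated_columns(2)[OF v s nz(1) that] fin by simp
  qed
qed

lemma maximum_projectivity_quaternary_design:
  assumes full: "odd_entries + num_entries v 2 = n" and v2: "num_entries v 2 \<le> 1"
  shows "maximum_projectivity (2 ^ (2 * n)) (2 * n + 2) QD"
proof (rule maximum_projectivity_quarterI[OF quaternary_design_in_two_level_designs[OF v]])
  show "has_projectivity QD (2 * n + 2 - 3)"
    using has_projectivity_quaternary_design[OF v n nonzero_entries[OF full] v2] by simp
qed (use n in \<open>simp_all add: power_add\<close>)

text \<open>The half-fraction again has a quarter of the \<open>2 ^ (2 * n + 1)\<close> symbol
  combinations as its number of runs; \<open>n \<ge> 2\<close> supplies the four columns that the
  upper bound requires.\<close>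

lemma maximum_projectivity_half_fraction:
  assumes full: "odd_entries + num_entries v 2 = n" and v2: "num_entries v 2 \<le> 1"
    and n2: "n \<ge> 2" and b: "b < 2 * n + 2" and t: "t \<in> {1, -1}"
  shows "maximum_projectivity (2 ^ (2 * n - 1)) (2 * n + 1) (half_fraction QD b t)"
proof -
  have b': "b < 2 * n + 1 + 1" using b by simp
  have "word_sum QD {b} = 0"
    using balanced_column b full n by simp
  note half = quaternary_design_as_double b' t this
  show ?thesis
  proof (rule maximum_projectivity_quarterI[OF half_fraction_in_two_level_designs[OF half]])
    have "Suc (2 * n + 1 - 3) = 2 * n - 1"
      using n2 by simp
    then have "has_projectivity QD (Suc (2 * n + 1 - 3))"
      using has_projectivity_quaternary_design[OF v n nonzero_entries[OF full] v2] by simp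
    then show "has_projectivity (half_fraction QD b t) (2 * n + 1 - 3)"
      by (rule has_projectivity_half_fraction[OF half])
    show "4 * 2 ^ (2 * n - 1) = (2 :: nat) ^ (2 * n + 1)"
      using n2 power_add[of "2 :: nat" "2 * n - 1" 2] by simp
  qed (use n2 in simp)
qed

end

text \<open>The last clause carries \<open>n \<ge> 2\<close> because it is false for
  \<open>n = 1\<close>: \<open>half_fraction_not_maximum_projectivity\<close> refutes it when the
  entry of \<open>v\<close> is 1 or 2.\<close>

theorem theorem10:
  fixes n :: nat and v :: "4 vec"
  assumes "n \<ge> 1" and "v \<in> carrier_vec n"
  shows
    "(\<forall>k\<ge>1.
        (n = 3 * k - 1 \<and> num_entries v 1 + num_entries v 3 = 2 * k - 1 \<and> num_entries v 2 = k \<or>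
         n = 3 * k \<and> num_entries v 1 + num_entries v 3 = 2 * k \<and> num_entries v 2 = k \<or>
         n = 3 * k + 1 \<and> num_entries v 1 + num_entries v 3 = 2 * k \<and> num_entries v 2 = k + 1)
        \<longrightarrow> minimum_aberration (2 ^ (2 * n)) (2 * n + 2) (quaternary_design v)) \<and>
     (\<forall>k\<ge>1. \<forall>b. \<forall>s\<in>{1, -1}.
        (n = 3 * k - 1 \<and> num_entries v 1 + num_entries v 3 = 2 * k - 1 \<and> num_entries v 2 = k \<and>
           b \<in> associated_columns v 2 \<or>
         n = 3 * k \<and> num_entries v 1 + num_entries v 3 = 2 * k \<and> num_entries v 2 = k \<and>
           b \<in> associated_columns v 1 \<or>
         n = 3 * k + 1 \<and> num_entries v 1 + num_entries v 3 = 2 * k \<and> num_entries v 2 = k + 1 \<and>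
           b \<in> associated_columns v 2)
        \<longrightarrow> minimum_aberration (2 ^ (2 * n - 1)) (2 * n + 1)
              (half_fraction (quaternary_design v) b s)) \<and>
     (num_entries v 1 + num_entries v 3 = n - 1 \<and> num_entries v 2 = 1 \<or>
      num_entries v 1 + num_entries v 3 = n \<and> num_entries v 2 = 0
      \<longrightarrow> maximum_projectivity (2 ^ (2 * n)) (2 * n + 2) (quaternary_design v) \<and>
          (n \<ge> 2 \<longrightarrow>
            (\<forall>b<2 * n + 2. \<forall>s\<in>{1, -1}.
               maximum_projectivity (2 ^ (2 * n - 1)) (2 * n + 1)
                 (half_fraction (quaternary_design v) b s))))"
proof (intro conjI allI impI ballI)
  fix k :: nat
  assume "k \<ge> 1"
    and "n = 3 * k - 1 \<and> num_entries v 1 + num_entries v 3 = 2 * k - 1 \<and> num_entries v 2 = k \<or>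
         n = 3 * k \<and> num_entries v 1 + num_entries v 3 = 2 * k \<and> num_entries v 2 = k \<or>
         n = 3 * k + 1 \<and> num_entries v 1 + num_entries v 3 = 2 * k \<and> num_entries v 2 = k + 1"
  then consider
    "n = 3 * k - 1" "num_entries v 1 + num_entries v 3 = 2 * k - 1" "num_entries v 2 = k"
    | "n = 3 * k" "num_entries v 1 + num_entries v 3 = 2 * k" "num_entries v 2 = k"
    | "n = 3 * k + 1" "num_entries v 1 + num_entries v 3 = 2 * k" "num_entries v 2 = k + 1"
    by blast
  then show "minimum_aberration (2 ^ (2 * n)) (2 * n + 2) (quaternary_design v)"
  proof cases
    \<comment> \<open>Both word lengths are \<open>4 * k\<close> here; they are
      \<open>4 * k + 1\<close> and \<open>4 * k + 2\<close> in the second case,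
      \<open>4 * k + 3\<close> and \<open>4 * k + 2\<close> in the third. \<open>K\<close> is the
      smaller one.\<close>
    case 1
    with \<open>k \<ge> 1\<close> show ?thesis
      by (intro minimum_aberration_quaternary_design[OF assms(2,1), of "4 * k"]) auto
  next
    case 2
    with \<open>k \<ge> 1\<close> show ?thesis
      by (intro minimum_aberration_quaternary_design[OF assms(2,1), of "4 * k + 1"]) auto
  next
    case 3
    with \<open>k \<ge> 1\<close> show ?thesis
      by (intro minimum_aberration_quaternary_design[OF assms(2,1), of "4 * k + 2"]) auto
  qed
next
  fix k b :: nat and s :: int
  assume "k \<ge> 1" and s: "s \<in> {1, -1}"
    and "n = 3 * k - 1 \<and> num_entries v 1 + num_entries v 3 = 2 * k - 1 \<and> num_entries v 2 = k \<and>
           b \<in> associated_columns v 2 \<or>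
         n = 3 * k \<and> num_entries v 1 + num_entries v 3 = 2 * k \<and> num_entries v 2 = k \<and>
           b \<in> associated_columns v 1 \<or>
         n = 3 * k + 1 \<and> num_entries v 1 + num_entries v 3 = 2 * k \<and> num_entries v 2 = k + 1 \<and>
           b \<in> associated_columns v 2"
  then consider
    "n = 3 * k - 1" "num_entries v 1 + num_entries v 3 = 2 * k - 1" "num_entries v 2 = k"
      "b \<in> associated_columns v 2"
    | "n = 3 * k" "num_entries v 1 + num_entries v 3 = 2 * k" "num_entries v 2 = k"
      "b \<in> associated_columns v 1"
    | "n = 3 * k + 1" "num_entries v 1 + num_entries v 3 = 2 * k" "num_entries v 2 = k + 1"
      "b \<in> associated_columns v 2"
    by blast
  then show "minimum_aberration (2 ^ (2 * n - 1)) (2 * n + 1)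
      (half_fraction (quaternary_design v) b s)"
  proof cases
    \<comment> \<open>Without \<open>b\<close> the lengths are \<open>4 * k - 1\<close> and
      \<open>4 * k\<close> here, \<open>4 * k\<close> and \<open>4 * k + 1\<close> in the second
      case, and only \<open>4 * k + 2\<close> in the third.\<close>
    case 1
    show ?thesis
    proof (rule minimum_aberration_half_fraction[OF assms(2,1) _ associated_columns_less[OF assms(2,1) 1(4)] s, of "4 * k - 1"])
      show "card (w - {b}) \<in> {4 * k - 1, 4 * k - 1 + 1}"
        if "w \<subseteq> {..<2 * n + 2}" "word_sum (quaternary_design v) w \<noteq> 0" "w \<noteq> {}" for w
        using card_word_minus(1)[OF assms(2,1) that 1(4)] 1 \<open>k \<ge> 1\<close> by auto
    qed (use 1 \<open>k \<ge> 1\<close> in auto)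
  next
    case 2
    show ?thesis
    proof (rule minimum_aberration_half_fraction[OF assms(2,1) _ associated_columns_less[OF assms(2,1) 2(4)] s, of "4 * k"])
      show "card (w - {b}) \<in> {4 * k, 4 * k + 1}"
        if "w \<subseteq> {..<2 * n + 2}" "word_sum (quaternary_design v) w \<noteq> 0" "w \<noteq> {}" for w
        using card_word_minus(2)[OF assms(2,1) that 2(4)] 2 by auto
    qed (use 2 \<open>k \<ge> 1\<close> in auto)
  next
    case 3
    show ?thesis
    proof (rule minimum_aberration_half_fraction[OF assms(2,1) _ associated_columns_less[OF assms(2,1) 3(4)] s, of "4 * k + 2"])
      show "card (w - {b}) \<in> {4 * k + 2, 4 * k + 2 + 1}"
        if "w \<subseteq> {..<2 * n + 2}" "word_sum (quaternary_design v) w \<noteq> 0" "w \<noteq> {}" for w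
        using card_word_minus(1)[OF assms(2,1) that 3(4)] 3 by auto
    qed (use 3 \<open>k \<ge> 1\<close> in auto)
  qed
next
  assume "num_entries v 1 + num_entries v 3 = n - 1 \<and> num_entries v 2 = 1 \<or>
      num_entries v 1 + num_entries v 3 = n \<and> num_entries v 2 = 0"
  then have counts: "num_entries v 1 + num_entries v 3 + num_entries v 2 = n" "num_entries v 2 \<le> 1"
    using assms(1) by auto
  show "maximum_projectivity (2 ^ (2 * n)) (2 * n + 2) (quaternary_design v)"
    by (rule maximum_projectivity_quaternary_design[OF assms(2,1) counts])
  fix b :: nat and s :: int
  assume "n \<ge> 2" "b < 2 * n + 2" "s \<in> {1, -1}"
  then show "maximum_projectivity (2 ^ (2 * n - 1)) (2 * n + 1)
      (half_fraction (quaternary_design v) b s)"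
    by (rule maximum_projectivity_half_fraction[OF assms(2,1) counts])
qed

end
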